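(* Let $n>3$ be odd, let $Q$ be a nondegenerate quadratic form on $\mathbb{F}_5^n$ with associated bilinear form $B$, and let $\varepsilon=\mu\bigl((-1)^{\frac{n-1}{2}}\det Q\bigr)$. Let $S^+=\{\{\mathbf v,-\mathbf v\} : \mathbf v\in\mathbb{F}_5^n,\ Q(\mathbf v)=1\}$, and let $A_0,A_1,A_2$ be the adjacency matrices of the relations on $S^+$ $$\mathcal R_0=\{(\mathbf v,\mathbf u): B(\mathbf v,\mathbf u)=0\},\quad \mathcal R_1=\{(\mathbf v,\mathbf u): \mathbf v\neq\mathbf u,\ B(\mathbf v,\mathbf u)=\pm1\},\quad \mathcal R_2=\{(\mathbf v,\mathbf u): B(\mathbf v,\mathbf u)=\pm2\}.$$ Then $A_2$ is the adjacency matrix of an edge-regular Deza graph with parameters $$ \left( \frac{5^{n-1} + \varepsilon 5^{\frac{n-1}{2}}}{2},\; 5^{n-2} - \varepsilon 5^{\frac{n-3}{2}},\; 2(5^{n-3} - \varepsilon 5^{\frac{n-3}{2}}),\; 2\cdot5^{n-3} - \varepsilon 5^{\frac{n-3}{2}} \right). $$ Moreover, $A_0$ and $A_1+A_2$ are adjacency matrices of complementary strongly regular graphs, the graphs with adjacency matrices $A_0$ and $A_1+A_2$ are the children of the Deza graph with adjacency matrix $A_2$, and $A_0$ is the adjacency matrix of a strongly regular graph with parameters $$ \left( \frac{5^{n-1} + \varepsilon 5^{\frac{n-1}{2}}}{2},\; \frac{5^{n-2} - \varepsilon 5^{\frac{n-3}{2}}}{2},\; \frac{5^{n-3} + \varepsilon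 5^{\frac{n-3}{2}}}{2},\; \frac{5^{n-3} - \varepsilon 5^{\frac{n-3}{2}}}{2} \right). $$
   Context: $B(\mathbf x,\mathbf y)=\frac12(Q(\mathbf x+\mathbf y)-Q(\mathbf x)-Q(\mathbf y))$, so $B(\mathbf x,\mathbf x)=Q(\mathbf x)$. Every nondegenerate quadratic form over a finite field of odd characteristic is equivalent to some $x_1^2+\dots+x_{n-1}^2+d x_n^2$ with $d\neq0$; one sets $\det Q=d$ (well defined up to nonzero squares). $\mu$ is the quadratic character of $\mathbb{F}_5$ ($\mu(0)=0$). An element $\{\mathbf v,-\mathbf v\}$ of $S^+$ is identified with either representative $\mathbf v$ (so $\mathbf v\ne\mathbf u$ in $S^+$ means $\mathbf v\neq\pm\mathbf u$ as vectors); $B$ is then defined up to sign. Graphs are finite, simple and undirected; $\Gamma(v)$ is the set of neighbours of $v$. A graph is a Deza graph with parameters $(N,k,b,a)$ if it has $N$ vertices, is $k$-regular, and $|\Gamma(u)\cap\Gamma(v)|\in\{a,b\}$ for any two distinct vertices $u,v$ (no order between $a$ and $b$ is imposed here). If $a\ne b$, its children are the two graphs on the same vertex set in which two distinct vertices are adjacent iff they have exactly $a$ (respectively exactly $b$) common neighbours. A regular graph is edge-regular if any two adjacent vertices have the same number of common neighbours. A graph is strongly regular with parameters $(N,k,\lambda,\mu')$ if it has $N$ vertices, is $k$-regular, any two adjacent vertices have exactly $\lambda$ common neighbours, and any two distinct non-adjacent vertices have exactly $\mu'$ common neighbours. *)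

theory Defs
  imports "HOL-Analysis.Analysis" "Graph_Theory.Pair_Digraph"
begin

definition quadratic_form :: "('f::field ^ 'n \<Rightarrow> 'f) \<Rightarrow> bool" where
  "quadratic_form Q \<longleftrightarrow>
     (\<exists>a :: 'n \<Rightarrow> 'n \<Rightarrow> 'f. \<forall>x. Q x = (\<Sum>i\<in>UNIV. \<Sum>j\<in>UNIV. a i j * x $ i * x $ j))"

definition assoc_form :: "('f::field ^ 'n \<Rightarrow> 'f) \<Rightarrow> 'f ^ 'n \<Rightarrow> 'f ^ 'n \<Rightarrow> 'f" where
  "assoc_form Q x y = (Q (x + y) - Q x - Q y) / 2"

definition nondegenerate :: "('f::field ^ 'n \<Rightarrow> 'f) \<Rightarrow> bool" where
  "nondegenerate Q \<longleftrightarrow> (\<forall>x. (\<forall>y. assoc_form Q x y = 0) \<longrightarrow> x = 0)"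

definition equivalent_forms :: "('f::field ^ 'n \<Rightarrow> 'f) \<Rightarrow> ('f ^ 'n \<Rightarrow> 'f) \<Rightarrow> bool" where
  "equivalent_forms Q Q' \<longleftrightarrow>
     (\<exists>T :: 'f ^ 'n ^ 'n. invertible T \<and> (\<forall>x. Q' x = Q (T *v x)))"

text \<open>The form with coefficient \<open>d\<close> at the coordinate \<open>k\<close> and \<open>1\<close> at all others. The index
  type has no distinguished last element; all choices of \<open>k\<close> give equivalent forms.\<close>

definition normal_form :: "'n \<Rightarrow> 'f::field \<Rightarrow> 'f ^ 'n \<Rightarrow> 'f" where
  "normal_form k d x = (\<Sum>i\<in>UNIV - {k}. (x $ i)\<^sup>2) + d * (x $ k)\<^sup>2"

text \<open>The determinant is only well defined up to nonzero squares, so one representative is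
  chosen. A suitable \<open>d\<close> exists whenever \<open>Q\<close> is a nondegenerate quadratic form over a finite
  field of odd characteristic.\<close>

definition form_det :: "('f::field ^ 'n \<Rightarrow> 'f) \<Rightarrow> 'f" where
  "form_det Q = (SOME d. d \<noteq> 0 \<and> (\<exists>k. equivalent_forms Q (normal_form k d)))"

definition quadratic_character :: "'f::field \<Rightarrow> int" where
  "quadratic_character x = (if x = 0 then 0 else if \<exists>y. x = y\<^sup>2 then 1 else -1)"

definition S_plus :: "('f::field ^ 'n \<Rightarrow> 'f) \<Rightarrow> ('f ^ 'n) set set" where
  "S_plus Q = {{v, - v} | v. Q v = 1}"

text \<open>The members of a point \<open>p\<close> of \<open>S\<^sup>+\<close> are exactly its two representatives; the
  conditions below do not depend on which of them is taken.\<close>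

definition R0 :: "('f::field ^ 'n \<Rightarrow> 'f) \<Rightarrow> ('f ^ 'n) set rel" where
  "R0 Q = {(p, q) \<in> S_plus Q \<times> S_plus Q. \<exists>v\<in>p. \<exists>u\<in>q. assoc_form Q v u = 0}"

definition R1 :: "('f::field ^ 'n \<Rightarrow> 'f) \<Rightarrow> ('f ^ 'n) set rel" where
  "R1 Q = {(p, q) \<in> S_plus Q \<times> S_plus Q.
             p \<noteq> q \<and> (\<exists>v\<in>p. \<exists>u\<in>q. assoc_form Q v u \<in> {1, -1})}"

definition R2 :: "('f::field ^ 'n \<Rightarrow> 'f) \<Rightarrow> ('f ^ 'n) set rel" where
  "R2 Q = {(p, q) \<in> S_plus Q \<times> S_plus Q. \<exists>v\<in>p. \<exists>u\<in>q. assoc_form Q v u \<in> {2, -2}}"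

text \<open>Matrices with rows and columns indexed by a set \<open>V\<close> are functions of two arguments, of
  which only the values on \<open>V \<times> V\<close> matter.\<close>

definition relation_matrix :: "'a rel \<Rightarrow> 'a \<Rightarrow> 'a \<Rightarrow> int" where
  "relation_matrix R u v = (if (u, v) \<in> R then 1 else 0)"

text \<open>The locale predicate \<^const>\<open>pair_graph\<close> describes finite, loopless, symmetric digraphs
  without parallel arcs, that is, finite simple undirected graphs.\<close>

definition adjacency_matrix :: "('a \<Rightarrow> 'a \<Rightarrow> int) \<Rightarrow> 'a pair_pre_digraph \<Rightarrow> bool" where
  "adjacency_matrix A G \<longleftrightarrow>
     (\<forall>u\<in>pverts G. \<forall>v\<in>pverts G. A u v = (if (u, v) \<in> parcs G then 1 else 0))"

definition nbrs :: "'a pair_pre_digraph \<Rightarrow> 'a \<Rightarrow> 'a set" where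
  "nbrs G v = {u. (v, u) \<in> parcs G}"

definition common_nbrs :: "'a pair_pre_digraph \<Rightarrow> 'a \<Rightarrow> 'a \<Rightarrow> nat" where
  "common_nbrs G u v = card (nbrs G u \<inter> nbrs G v)"

text \<open>Parameters are taken as real numbers, so that closed formulas with division and
  subtraction can be used for them without rounding or truncation.\<close>

definition regular :: "'a pair_pre_digraph \<Rightarrow> real \<Rightarrow> bool" where
  "regular G k \<longleftrightarrow> (\<forall>v\<in>pverts G. real (card (nbrs G v)) = k)"

definition deza_graph :: "'a pair_pre_digraph \<Rightarrow> real \<Rightarrow> real \<Rightarrow> real \<Rightarrow> real \<Rightarrow> bool" where
  "deza_graph G N k b a \<longleftrightarrow>
     pair_graph G \<and> real (card (pverts G)) = N \<and> regular G k \<and>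
     (\<forall>u\<in>pverts G. \<forall>v\<in>pverts G. u \<noteq> v \<longrightarrow> real (common_nbrs G u v) \<in> {a, b})"

definition edge_regular :: "'a pair_pre_digraph \<Rightarrow> bool" where
  "edge_regular G \<longleftrightarrow>
     pair_graph G \<and> (\<exists>k. regular G k) \<and>
     (\<exists>l. \<forall>(u, v)\<in>parcs G. common_nbrs G u v = l)"

definition strongly_regular :: "'a pair_pre_digraph \<Rightarrow> real \<Rightarrow> real \<Rightarrow> real \<Rightarrow> real \<Rightarrow> bool" where
  "strongly_regular G N k l m \<longleftrightarrow>
     pair_graph G \<and> real (card (pverts G)) = N \<and> regular G k \<and>
     (\<forall>(u, v)\<in>parcs G. real (common_nbrs G u v) = l) \<and>
     (\<forall>u\<in>pverts G. \<forall>v\<in>pverts G. u \<noteq> v \<and> (u, v) \<notin> parcs G \<longrightarrow> real (common_nbrs G u v) = m)"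

definition complement_graph :: "'a pair_pre_digraph \<Rightarrow> 'a pair_pre_digraph" where
  "complement_graph G =
     \<lparr>pverts = pverts G,
      parcs = {(u, v) \<in> pverts G \<times> pverts G. u \<noteq> v \<and> (u, v) \<notin> parcs G}\<rparr>"

definition deza_child :: "'a pair_pre_digraph \<Rightarrow> real \<Rightarrow> 'a pair_pre_digraph" where
  "deza_child G c =
     \<lparr>pverts = pverts G,
      parcs = {(u, v) \<in> pverts G \<times> pverts G. u \<noteq> v \<and> real (common_nbrs G u v) = c}\<rparr>"

text \<open>Children are only defined for \<open>a \<noteq> b\<close>, and they are an unordered pair.\<close>

definition deza_children ::
  "'a pair_pre_digraph \<Rightarrow> real \<Rightarrow> real \<Rightarrow> 'a pair_pre_digraph \<Rightarrow> 'a pair_pre_digraph \<Rightarrow> bool" where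
  "deza_children G b a H H' \<longleftrightarrow> a \<noteq> b \<and> {H, H'} = {deza_child G a, deza_child G b}"

end

(* A point count for the system Q u = 1, B x u = c ((x, c) ranging over a subspace P of V x F_5) is
   expanded with the additive characters of F_5. Completing the square and evaluating Gauss sums,
   the nontrivial characters contribute
     mu(det Q) * 5 ^ ((n + 1) / 2) * (SUM (x, c) : P. mu(Q x - c - 1)),
   because sum_t mu(t) psi(t y) = gamma mu(y) with gamma^2 = 5, where psi is a nontrivial additive
   and mu the quadratic character. This also covers the planes spanned
   by u, v with B u v = 1 or -1, on which Q is degenerate. For P spanned by one or two points of the
   quadric the remaining sums of mu depend only on B u v and have at most 25 terms; they give
   the degrees and the numbers of common neighbours, up to the factor 2 for passing from vectors to
   pairs {v, -v}. *)

theory Submission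
  imports Defs "HOL-Number_Theory.Residues"
begin

section \<open>Characters and Gauss sums over the field with five elements\<close>

text \<open>Odd n is what makes the powers of gamma combine to an integer: the Gauss sum of t Q is
  mu(t)^n mu(det Q) gamma^n, for odd n one factor mu(t) survives, and so the sum over t is one more
  Gauss sum, with total power gamma^(n+1). That P is a subspace matters twice: the characters given
  by its elements add up to card P or to 0, and P is stable under multiplication by t, so that t can
  be spread over the linear equations and a single square be completed. The Deza property rests on a
  coincidence in dimension 2. Among the planes spanned by two points, those with B u v = 0 are
  hyperbolic, those with B u v = 2 or -2 anisotropic, those with B u v = 1 or -1 degenerate; the
  last two types give equal totals of character sums. Hence the numbers of common neighbours only
  see orthogonality, which is why the children are A_0 and its complement. As
  \<open>form_det\<close> is chosen by SOME, a diagonal form of Q has to be constructed before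
  anything is known about it.\<close>

definition chi5 :: "int \<Rightarrow> int" where
  "chi5 k = (if k mod 5 = 0 then 0 else if k mod 5 \<in> {1, 4} then 1 else -1)"

definition zeta5 :: complex where
  "zeta5 = cis (2 * pi / 5)"

lemma zeta5_pow5: "zeta5 ^ 5 = 1"
proof -
  have "zeta5 ^ 5 = cis (real 5 * (2 * pi / 5))"
    unfolding zeta5_def by (rule Complex.DeMoivre)
  thus ?thesis by simp
qed

lemma zeta5_mod: "zeta5 ^ k = zeta5 ^ (k mod 5)"
proof -
  have "zeta5 ^ k = zeta5 ^ (5 * (k div 5) + k mod 5)"
    by simp
  also have "\<dots> = zeta5 ^ (k mod 5)"
    unfolding power_add power_mult zeta5_pow5 by simp
  finally show ?thesis .
qed

lemma zeta5_sum: "1 + zeta5 + zeta5 ^ 2 + zeta5 ^ 3 + zeta5 ^ 4 = 0"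
proof -
  have "zeta5 \<noteq> 1"
  proof
    assume "zeta5 = 1"
    hence "cos (2 * pi / 5) = 1"
      by (simp add: zeta5_def complex_eq_iff)
    moreover have "cos (2 * pi / 5) < cos 0"
      using pi_gt_zero by (intro cos_monotone_0_pi) auto
    ultimately show False by simp
  qed
  moreover have "(zeta5 - 1) * (1 + zeta5 + zeta5 ^ 2 + zeta5 ^ 3 + zeta5 ^ 4) = zeta5 ^ 5 - 1"
    by (simp add: algebra_simps eval_nat_numeral)
  ultimately show ?thesis
    using zeta5_pow5 by simp
qed

text \<open>The quadratic Gauss sum of \<open>zeta5 ^ (x^2)\<close> over x in F_5: the square 0
  occurs once, 1 and 4 occur twice each.\<close>

definition gauss5 :: complex where
  "gauss5 = 1 + 2 * zeta5 + 2 * zeta5 ^ 4"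

lemma gauss5_sq: "gauss5 ^ 2 = 5"
proof -
  have *: "zeta5 ^ 8 = zeta5 ^ 3"
    by (subst zeta5_mod) simp
  have "gauss5 ^ 2 = 1 + 4 * zeta5 + 4 * zeta5 ^ 2 + 4 * zeta5 ^ 4 + 8 * zeta5 ^ 5 + 4 * zeta5 ^ 8"
    by (simp add: gauss5_def algebra_simps eval_nat_numeral)
  also have "\<dots> = 5 + 4 * (1 + zeta5 + zeta5 ^ 2 + zeta5 ^ 3 + zeta5 ^ 4)"
    unfolding * zeta5_pow5 by simp
  finally show ?thesis
    unfolding zeta5_sum by simp
qed

text \<open>Subtracting the vanishing sum of all powers of \<open>zeta5\<close> turns the sum over
  squares into the sum of mu(t) \<open>zeta5 ^ t\<close>, the shape met in
  \<open>gauss_sum_qc\<close>.\<close>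

lemma gauss5_alt: "gauss5 = zeta5 + zeta5 ^ 4 - zeta5 ^ 2 - zeta5 ^ 3"
  using zeta5_sum by (simp add: gauss5_def algebra_simps) algebra

text \<open>The additive character that sends 1 to \<open>zeta5\<close>, evaluated at the
  representative below 5; the description has a unique solution for every argument once the field
  has five elements.\<close>

definition psi5 :: "'f::field \<Rightarrow> complex" where
  "psi5 x = zeta5 ^ (THE k. k < 5 \<and> of_nat k = x)"

locale form5 =
  fixes Q :: "'f::{field,finite} ^ 'n \<Rightarrow> 'f"
  assumes card_field: "CARD('f) = 5"
    and quad: "quadratic_form Q"
    and nondeg: "nondegenerate Q"
begin

section \<open>Arithmetic in the field with five elements\<close>

lemma char5: "CHAR('f) = 5"
proof -
  have "CHAR('f) dvd 5"
    using CHAR_dvd_CARD[where 'a = 'f] card_field by simp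
  moreover have "prime (5::nat)" by simp
  ultimately have "CHAR('f) = 1 \<or> CHAR('f) = 5"
    by (metis prime_nat_iff)
  thus ?thesis
    by auto
qed

lemma of_int_eq_iff5: "(of_int a :: 'f) = of_int b \<longleftrightarrow> a mod 5 = b mod 5"
  using of_int_eq_iff_cong_CHAR[where 'a = 'f] char5 by (simp add: cong_def)

lemma of_nat_eq_iff5: "(of_nat a :: 'f) = of_nat b \<longleftrightarrow> a mod 5 = b mod 5"
  using of_nat_eq_iff_cong_CHAR[where 'a = 'f] char5 by (simp add: cong_def)

lemma UNIV_field: "(UNIV :: 'f set) = of_nat ` {..<5}"
proof -
  have "inj_on (of_nat :: nat \<Rightarrow> 'f) {..<5}"
    by (auto simp: inj_on_def of_nat_eq_iff5)
  hence "card (of_nat ` {..<5} :: 'f set) = CARD('f)"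
    by (simp add: card_image card_field)
  thus ?thesis
    by (intro card_subset_eq[symmetric]) auto
qed

lemma sum_field: "(\<Sum>x\<in>UNIV. h (x :: 'f)) = h 0 + h 1 + h 2 + h 3 + (h 4 :: 'c::comm_monoid_add)"
proof -
  have "inj_on (of_nat :: nat \<Rightarrow> 'f) {..<5}"
    by (auto simp: inj_on_def of_nat_eq_iff5)
  thus ?thesis
    unfolding UNIV_field by (simp add: sum.reindex eval_nat_numeral ac_simps)
qed

lemma field_cases5: "(x :: 'f) = 0 \<or> x = 1 \<or> x = 2 \<or> x = 3 \<or> x = 4"
proof -
  have "x \<in> of_nat ` {..<5}"
    using UNIV_field by blast
  thus ?thesis
    by (auto simp: eval_nat_numeral less_Suc_eq)
qed

lemma of_nat_exhaust: obtains k where "(x :: 'f) = of_nat k"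
  using UNIV_field by blast

text \<open>All that is known about the type is its cardinality. These instances, one for each
  syntactic shape of the two sides, let \<open>simp\<close> decide equations between numerals by
  reduction mod 5.\<close>

lemmas numeral_eq_iff5 =
  of_int_eq_iff5[of "numeral a" "numeral b" for a b, unfolded of_int_numeral]
  of_int_eq_iff5[of "numeral a" 0 for a, unfolded of_int_numeral of_int_0]
  of_int_eq_iff5[of "numeral a" 1 for a, unfolded of_int_numeral of_int_1]
  of_int_eq_iff5[of 1 "numeral a" for a, unfolded of_int_numeral of_int_1]
  of_int_eq_iff5[of "- numeral a" "numeral b" for a b, unfolded of_int_minus of_int_numeral]
  of_int_eq_iff5[of "- numeral a" 1 for a, unfolded of_int_minus of_int_numeral of_int_1]
  of_int_eq_iff5[of "-1" "numeral b" for b, unfolded of_int_minus of_int_numeral of_int_1]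
  of_int_eq_iff5[of "numeral b" "-1" for b, unfolded of_int_minus of_int_numeral of_int_1]
  of_int_eq_iff5[of "numeral b" "- numeral a" for a b, unfolded of_int_minus of_int_numeral]
  of_int_eq_iff5[of 1 "- numeral a" for a, unfolded of_int_minus of_int_numeral of_int_1]

text \<open>The squares mod 5 are 0, 1 and 4. Passing to integer representatives makes the values of
  the character on numerals computable.\<close>

lemma qc_of_int: "quadratic_character (of_int k :: 'f) = chi5 k"
proof -
  have "(\<exists>y::'f. of_int k = y\<^sup>2) \<longleftrightarrow> k mod 5 \<in> {0, 1, 4}"
  proof -
    have "(\<exists>y::'f. of_int k = y\<^sup>2) \<longleftrightarrow> (\<exists>m\<in>{..<5}. (of_int k :: 'f) = (of_nat m)\<^sup>2)"
      using UNIV_field by (metis UNIV_I imageE)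
    also have "\<dots> \<longleftrightarrow> (\<exists>m\<in>{..<5::nat}. (of_int k :: 'f) = of_int ((int m)\<^sup>2))"
      by simp
    also have "\<dots> \<longleftrightarrow> (\<exists>m\<in>{..<5::nat}. k mod 5 = (int m)\<^sup>2 mod 5)"
      unfolding of_int_eq_iff5 ..
    also have "\<dots> \<longleftrightarrow> k mod 5 \<in> {0, 1, 4}"
      by (simp add: eval_nat_numeral lessThan_Suc) auto
    finally show ?thesis .
  qed
  thus ?thesis
    using of_int_eq_iff5[of k 0] by (auto simp: quadratic_character_def chi5_def)
qed

lemma qc_numeral:
  "quadratic_character (0 :: 'f) = 0"
  "quadratic_character (1 :: 'f) = 1"
  "quadratic_character (- 1 :: 'f) = 1"
  "quadratic_character (numeral a :: 'f) = chi5 (numeral a)"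
  "quadratic_character (- numeral a :: 'f) = chi5 (- numeral a)"
  using qc_of_int[of 0] qc_of_int[of 1] qc_of_int[of "-1"] qc_of_int[of "numeral a"]
    qc_of_int[of "- numeral a"]
  by (simp_all add: chi5_def)

lemma qc_mult:
  "quadratic_character (x * y :: 'f) = quadratic_character x * quadratic_character y"
  using field_cases5[of x] field_cases5[of y]
  by (elim disjE) (simp_all add: qc_numeral chi5_def)

section \<open>The additive character and its Gauss sums\<close>

lemma psi5_of_nat: "psi5 (of_nat k :: 'f) = zeta5 ^ k"
proof -
  have "(THE m. m < 5 \<and> (of_nat m :: 'f) = of_nat k) = k mod 5"
    by (rule the_equality) (auto simp: of_nat_eq_iff5)
  thus ?thesis
    unfolding psi5_def using zeta5_mod[of k] by simp
qed

lemma psi5_numeral: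
  "psi5 (0 :: 'f) = 1" "psi5 (1 :: 'f) = zeta5" "psi5 (numeral a :: 'f) = zeta5 ^ (numeral a mod 5)"
proof -
  show "psi5 (0 :: 'f) = 1" "psi5 (1 :: 'f) = zeta5"
    using psi5_of_nat[of 0] psi5_of_nat[of 1] by simp_all
  show "psi5 (numeral a :: 'f) = zeta5 ^ (numeral a mod 5)"
    using psi5_of_nat[of "numeral a"] zeta5_mod[of "numeral a"] unfolding of_nat_numeral by argo
qed

lemma psi5_add: "psi5 (x + y :: 'f) = psi5 x * psi5 y"
proof -
  obtain a b where "x = of_nat a" "y = of_nat b"
    using of_nat_exhaust by metis
  thus ?thesis
    using psi5_of_nat[of "a + b"] by (simp add: psi5_of_nat power_add)
qed

lemma psi5_sum: "finite A \<Longrightarrow> psi5 (\<Sum>i\<in>A. h i :: 'f) = (\<Prod>i\<in>A. psi5 (h i))"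
  by (induction rule: finite_induct) (simp_all add: psi5_add psi5_numeral)

lemma sum_psi5_mult: "(\<Sum>t\<in>UNIV. psi5 (t * x :: 'f)) = (if x = 0 then 5 else 0)"
proof -
  note [simp] = sum_field psi5_numeral numeral_eq_iff5
  have *: "zeta5 + zeta5 ^ 2 + zeta5 ^ 3 + zeta5 ^ 4 = - 1"
    using zeta5_sum by (simp add: eq_neg_iff_add_eq_0 add_ac)
  consider "x = 0" | "x = 1" | "x = 2" | "x = 3" | "x = 4"
    using field_cases5[of x] by blast
  thus ?thesis
    using * by cases (auto simp: card_field add_ac power2_eq_square)
qed

text \<open>If \<open>psi5 x\<close> is 1, then so is each \<open>psi5 (t * x)\<close>, being a
  power of it; the sum over t is then 5, which \<open>sum_psi5_mult\<close> allows only for x =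
  0.\<close>

lemma psi5_eq_1_iff: "psi5 (x :: 'f) = 1 \<longleftrightarrow> x = 0"
proof
  assume *: "psi5 x = 1"
  have "psi5 (t * x) = 1" for t
  proof -
    obtain k where "t = of_nat k"
      by (rule of_nat_exhaust)
    moreover have "psi5 (of_nat k * x) = 1" for k
      by (induction k) (simp_all add: psi5_numeral psi5_add * algebra_simps)
    ultimately show ?thesis by simp
  qed
  thus "x = 0"
    using sum_psi5_mult[of x] by (auto split: if_splits)
qed (simp add: psi5_numeral)

text \<open>A nonzero square t permutes the nonzero squares, a nonsquare t carries them to the
  nonsquares 2 and 3; the sum over the nonsquares is the negative of \<open>gauss5\<close> because
  all powers of \<open>zeta5\<close> add up to 0.\<close>

lemma gauss_sum_sq: "(\<Sum>x\<in>UNIV. psi5 ((t :: 'f) * x\<^sup>2)) =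
    (if t = 0 then 5 else of_int (quadratic_character t) * gauss5)"
proof -
  note [simp] = sum_field psi5_numeral numeral_eq_iff5 qc_numeral chi5_def
  have *: "1 + 2 * zeta5 ^ 2 + 2 * zeta5 ^ 3 = - gauss5"
  proof -
    have "1 + 2 * zeta5 ^ 2 + 2 * zeta5 ^ 3 + gauss5 =
        2 * (1 + zeta5 + zeta5 ^ 2 + zeta5 ^ 3 + zeta5 ^ 4)"
      by (simp add: gauss5_def algebra_simps)
    thus ?thesis
      unfolding zeta5_sum by (simp add: eq_neg_iff_add_eq_0)
  qed
  consider "t = 0" | "t = 1" | "t = 2" | "t = 3" | "t = 4"
    using field_cases5[of t] by blast
  thus ?thesis
  proof cases
    case 1
    thus ?thesis by (simp add: card_field)
  next
    case 2
    thus ?thesis by (simp add: gauss5_def)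
  next
    case 3
    thus ?thesis using * by (simp add: algebra_simps power2_eq_square)
  next
    case 4
    thus ?thesis using * by (simp add: algebra_simps power2_eq_square power3_eq_cube)
  next
    case 5
    thus ?thesis by (simp add: gauss5_def)
  qed
qed

lemma gauss_sum_qc: "(\<Sum>t\<in>UNIV. of_int (quadratic_character t) * psi5 (t * x :: 'f)) =
    of_int (quadratic_character x) * gauss5"
proof -
  note [simp] = sum_field psi5_numeral numeral_eq_iff5 qc_numeral chi5_def
  consider "x = 0" | "x = 1" | "x = 2" | "x = 3" | "x = 4"
    using field_cases5[of x] by blast
  thus ?thesis
    by cases (simp_all add: gauss5_alt)
qed

end

section \<open>Orthogonal bases and the determinant\<close>

context form5
begin

abbreviation B :: "'f ^ 'n \<Rightarrow> 'f ^ 'n \<Rightarrow> 'f" where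
  "B \<equiv> assoc_form Q"

text \<open>The coefficients supplied by \<open>quadratic_form\<close> need not be symmetric. B has
  their symmetrization as its matrix, and the bilinearity of B is read off from this
  representation.\<close>

lemma bilinear_rep: "\<exists>b. \<forall>x y. B x y = (\<Sum>i\<in>UNIV. \<Sum>j\<in>UNIV. b i j * x $ i * y $ j)"
  and Q_scale: "Q (c *s x) = c\<^sup>2 * Q x"
proof -
  obtain a where a: "\<And>x. Q x = (\<Sum>i\<in>UNIV. \<Sum>j\<in>UNIV. a i j * x $ i * x $ j)"
    using quad unfolding quadratic_form_def by blast
  have "B x y = (\<Sum>i\<in>UNIV. \<Sum>j\<in>UNIV. (a i j + a j i) / 2 * x $ i * y $ j)" for x y
  proof -
    have "Q (x + y) - Q x - Q y =
        (\<Sum>i\<in>UNIV. \<Sum>j\<in>UNIV. a i j * x $ i * y $ j + a i j * x $ j * y $ i)"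
      unfolding a by (simp add: sum_subtractf[symmetric] algebra_simps)
    also have "\<dots> = (\<Sum>i\<in>UNIV. \<Sum>j\<in>UNIV. a i j * x $ i * y $ j) +
        (\<Sum>i\<in>UNIV. \<Sum>j\<in>UNIV. a i j * x $ j * y $ i)"
      by (simp add: sum.distrib)
    also have "(\<Sum>i\<in>UNIV. \<Sum>j\<in>UNIV. a i j * x $ j * y $ i) =
        (\<Sum>i\<in>UNIV. \<Sum>j\<in>UNIV. a j i * x $ i * y $ j)"
      by (rule sum.swap)
    finally show ?thesis
      unfolding assoc_form_def
      by (simp add: sum.distrib[symmetric] sum_divide_distrib algebra_simps add_divide_distrib)
  qed
  thus "\<exists>b. \<forall>x y. B x y = (\<Sum>i\<in>UNIV. \<Sum>j\<in>UNIV. b i j * x $ i * y $ j)"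
    by (intro exI[of _ "\<lambda>i j. (a i j + a j i) / 2"]) blast
  show "Q (c *s x) = c\<^sup>2 * Q x"
    unfolding a by (simp add: sum_distrib_left algebra_simps power2_eq_square)
qed

lemma B_commute: "B x y = B y x"
  by (simp add: assoc_form_def algebra_simps)

lemma B_add_left: "B (x + y) z = B x z + B y z"
  using bilinear_rep by (auto simp: algebra_simps sum.distrib)

lemma B_scale_left: "B (c *s x) y = c * B x y"
  using bilinear_rep by (auto simp: algebra_simps sum_distrib_left)

lemma B_add_right: "B z (x + y) = B z x + B z y"
  by (simp add: B_commute[of z] B_add_left)

lemma B_scale_right: "B y (c *s x) = c * B y x"
  by (simp add: B_commute[of y] B_scale_left)

lemma vec_minus_eq_scale: "- x = (- 1) *s (x :: 'f ^ 'n)"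
  by (simp add: vec_eq_iff)

lemma B_minus_left: "B (- x) y = - B x y"
  unfolding vec_minus_eq_scale B_scale_left by simp

lemma B_minus_right: "B y (- x) = - B y x"
  unfolding vec_minus_eq_scale B_scale_right by simp

lemma B_diff_left: "B (x - y) z = B x z - B y z"
  using B_add_left[of x "- y"] by (simp add: B_minus_left)

lemma B_diff_right: "B z (x - y) = B z x - B z y"
  by (simp add: B_commute[of z] B_diff_left)

lemma B_zero_left [simp]: "B 0 y = 0"
  using B_scale_left[of 0 0 y] by simp

lemma B_zero_right [simp]: "B y 0 = 0"
  using B_commute[of y 0] by simp

lemma B_sum_right: "finite A \<Longrightarrow> B y (\<Sum>i\<in>A. h i) = (\<Sum>i\<in>A. B y (h i))"
  by (induction rule: finite_induct) (simp_all add: B_add_right)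

lemma two_nonzero: "(2 :: 'f) \<noteq> 0"
  by (simp add: numeral_eq_iff5)

lemma B_self: "B x x = Q x"
proof -
  have "x + x = 2 *s x"
    by (simp add: vec_eq_iff)
  hence "Q (x + x) = 4 * Q x"
    by (simp add: Q_scale)
  hence "B x x = 2 * Q x / 2"
    unfolding assoc_form_def by simp
  thus ?thesis
    using two_nonzero by simp
qed

lemma Q_zero [simp]: "Q 0 = 0"
  using Q_scale[of 0 0] by simp

lemma Q_minus [simp]: "Q (- x) = Q x"
  unfolding vec_minus_eq_scale Q_scale by simp

lemma Q_add: "Q (x + y) = Q x + Q y + 2 * B x y"
proof -
  have "B x y * 2 = Q (x + y) - Q x - Q y"
    using iffD1[OF nonzero_eq_divide_eq[OF two_nonzero] assoc_form_def] .
  thus ?thesis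
    by (simp add: algebra_simps)
qed

lemma Q_diff: "Q (x - y) = Q x + Q y - 2 * B x y"
  using Q_add[of x "- y"] by (simp add: B_minus_right)

text \<open>Nonzero values of Q make such a family independent. Indexing by subsets of the
  coordinate type means that a family on UNIV is a basis whose members can serve as the columns of a
  matrix.\<close>

definition orthogonal_family :: "'n set \<Rightarrow> ('n \<Rightarrow> 'f ^ 'n) \<Rightarrow> bool" where
  "orthogonal_family I e \<longleftrightarrow>
     (\<forall>i\<in>I. Q (e i) \<noteq> 0) \<and> (\<forall>i\<in>I. \<forall>j\<in>I. i \<noteq> j \<longrightarrow> B (e i) (e j) = 0)"

lemma orthogonal_family_B_sum:
  assumes "orthogonal_family I e" "j \<in> I"
  shows "B (e j) (\<Sum>i\<in>I. c i *s e i) = c j * Q (e j)"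
proof -
  have "B (e j) (\<Sum>i\<in>I. c i *s e i) = (\<Sum>i\<in>I. if i = j then c j * Q (e j) else 0)"
    unfolding B_sum_right[OF finite] B_scale_right
    using assms by (intro sum.cong) (auto simp: orthogonal_family_def B_self)
  thus ?thesis
    using assms(2) by (simp add: sum.delta)
qed

text \<open>A counting argument instead of a dimension argument: the map f below never reaches a
  vector with a nonzero coordinate outside I, so on the finite space it is not injective either, and
  the difference of two vectors with equal images is the one wanted.\<close>

lemma orthogonal_vector_exists:
  fixes I :: "'n set"
  assumes "I \<noteq> UNIV"
  shows "\<exists>x. x \<noteq> 0 \<and> (\<forall>i\<in>I. B (e i) x = 0)"
proof -
  define f :: "'f ^ 'n \<Rightarrow> 'f ^ 'n" where "f x = (\<chi> i. if i \<in> I then B (e i) x else 0)" for x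
  obtain k where k: "k \<notin> I"
    using assms by blast
  have "(\<chi> i. 1) \<noteq> f x" for x
    using k by (auto simp: f_def vec_eq_iff)
  hence "\<not> surj f"
    by (metis surjD)
  hence "\<not> inj f"
    using finite_UNIV_inj_surj[OF finite] by blast
  then obtain x y where xy: "x \<noteq> y" "f x = f y"
    unfolding inj_def by blast
  have "B (e i) (x - y) = 0" if "i \<in> I" for i
    using arg_cong[OF xy(2), of "\<lambda>z. z $ i"] that by (simp add: f_def B_diff_right)
  with xy(1) show ?thesis
    by (intro exI[of _ "x - y"]) auto
qed

text \<open>If Q vanished on the whole orthogonal complement of the family, then B would vanish
  there by polarization. A nonzero x in the complement would thus be orthogonal to the complement
  and to the family, hence to everything, against nondegeneracy.\<close>

lemma orthogonal_family_extend:
  assumes "orthogonal_family I e" "I \<noteq> UNIV"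
  shows "\<exists>x. Q x \<noteq> 0 \<and> (\<forall>i\<in>I. B (e i) x = 0)"
proof (rule ccontr)
  assume contr: "\<not> ?thesis"
  obtain x where x: "x \<noteq> 0" "\<And>i. i \<in> I \<Longrightarrow> B (e i) x = 0"
    using orthogonal_vector_exists[OF assms(2)] by blast
  have "B x y = 0" for y
  proof -
    \<comment> \<open>The orthogonal projection of y to the span of the family; y - s lies in the
      complement.\<close>
    define s where "s = (\<Sum>i\<in>I. (B (e i) y / Q (e i)) *s e i)"
    have *: "B (e i) (y - s) = 0" if "i \<in> I" for i
    proof -
      have "Q (e i) \<noteq> 0"
        using assms(1) that by (simp add: orthogonal_family_def)
      thus ?thesis
        using orthogonal_family_B_sum[OF assms(1) that, of "\<lambda>i. B (e i) y / Q (e i)"]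
        by (simp add: s_def B_diff_right)
    qed
    have "Q (x + (y - s)) = 0" "Q x = 0" "Q (y - s) = 0"
      using contr x(2) * by (auto simp: B_add_right)
    hence "B x (y - s) = 0"
      by (simp add: assoc_form_def)
    moreover have "B x s = 0"
      unfolding s_def B_sum_right[OF finite] B_scale_right
      using x(2) B_commute[of x] by (intro sum.neutral) simp
    ultimately show ?thesis
      by (simp add: B_diff_right)
  qed
  hence "x = 0"
    using nondeg unfolding nondegenerate_def by blast
  with x(1) show False by simp
qed

lemma orthogonal_basis_exists: "\<exists>e. orthogonal_family UNIV e"
proof -
  have "\<exists>e. orthogonal_family I e" for I
  proof (induction I rule: finite_induct[OF finite])
    case 1
    show ?case by (simp add: orthogonal_family_def)
  next
    case (2 k I)
    then obtain e where e: "orthogonal_family I e" by blast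
    obtain x where x: "Q x \<noteq> 0" "\<And>i. i \<in> I \<Longrightarrow> B (e i) x = 0"
      using orthogonal_family_extend[OF e] 2 by blast
    moreover have "B x (e i) = 0" if "i \<in> I" for i
      using x(2)[OF that] B_commute by metis
    ultimately have "orthogonal_family (insert k I) (e(k := x))"
      using e 2 by (auto simp: orthogonal_family_def)
    thus ?case by blast
  qed
  thus ?thesis .
qed

text \<open>1 and 2 represent the two square classes of F_5. The witness c = 2 multiplies by 4,
  which sends 3 to 2 and 4 to 1.\<close>

lemma square_or_two_scale:
  assumes "(d :: 'f) \<noteq> 0"
  shows "\<exists>c. c \<noteq> 0 \<and> c\<^sup>2 * d \<in> {1, 2}"
proof -
  have "d = 1 \<or> d = 2 \<or> d = 3 \<or> d = 4"
    using field_cases5[of d] assms by blast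
  thus ?thesis
  proof (elim disjE)
    assume "d = 3" thus ?thesis by (intro exI[of _ 2]) (simp add: numeral_eq_iff5)
  next
    assume "d = 4" thus ?thesis by (intro exI[of _ 2]) (simp add: numeral_eq_iff5)
  qed (auto intro!: exI[of _ 1])
qed

text \<open>Take an orthogonal basis with as many vectors of value 1 as possible. Every other vector
  can be rescaled to value 2, since value 1 would contradict maximality. Two vectors x, y of value 2
  could be exchanged for 2 x + 2 y and 2 x - 2 y, which are orthogonal and have value 4 * 2 + 4 * 2
  = 1. So at most one index k is exceptional.\<close>

lemma almost_orthonormal_basis_exists:
  "\<exists>e k. orthogonal_family UNIV e \<and> (\<forall>i. i \<noteq> k \<longrightarrow> Q (e i) = 1)"
proof -
  define h where "h e = card {i. Q (e i) = 1}" for e :: "'n \<Rightarrow> 'f ^ 'n"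
  define E where "E = Collect (orthogonal_family UNIV)"
  have "finite (h ` E)" "h ` E \<noteq> {}"
    using orthogonal_basis_exists by (auto simp: E_def)
  hence "Max (h ` E) \<in> h ` E" "\<And>e. e \<in> E \<Longrightarrow> h e \<le> Max (h ` E)"
    by auto
  then obtain e where orth: "orthogonal_family UNIV e"
    and le: "\<And>e'. orthogonal_family UNIV e' \<Longrightarrow> h e' \<le> h e"
    unfolding E_def by (metis (no_types, lifting) imageE mem_Collect_eq)
  have max: "\<not> {i. Q (e i) = 1} \<subset> {i. Q (e' i) = 1}" if "orthogonal_family UNIV e'" for e'
  proof
    assume "{i. Q (e i) = 1} \<subset> {i. Q (e' i) = 1}"
    hence "h e < h e'"
      unfolding h_def by (intro psubset_card_mono) auto
    moreover have "h e' \<le> h e"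
      using le that .
    ultimately show False by simp
  qed
  have scale: "orthogonal_family UNIV (e(i := c *s e i))" if "c \<noteq> 0" for i c
    using orth that by (auto simp: orthogonal_family_def Q_scale B_scale_left B_scale_right)
  have two: "\<exists>c. c \<noteq> 0 \<and> Q (c *s e i) = 2" if "Q (e i) \<noteq> 1" for i
  proof -
    have "Q (e i) \<noteq> 0"
      using orth by (simp add: orthogonal_family_def)
    then obtain c where c: "c \<noteq> 0" "c\<^sup>2 * Q (e i) \<in> {1, 2}"
      using square_or_two_scale by blast
    have "Q (c *s e i) \<noteq> 1"
    proof
      assume "Q (c *s e i) = 1"
      hence "{i. Q (e i) = 1} \<subset> {j. Q ((e(i := c *s e i)) j) = 1}"
        using that by auto
      with max[OF scale[OF c(1)]] show False by blast
    qed
    with c show ?thesis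
      by (auto simp: Q_scale)
  qed
  have unique: "i = j" if ij: "Q (e i) \<noteq> 1" "Q (e j) \<noteq> 1" for i j
  proof (rule ccontr)
    assume "i \<noteq> j"
    obtain c d where cd: "Q (c *s e i) = 2" "Q (d *s e j) = 2"
      using two ij by meson
    define x where "x = c *s e i"
    define y where "y = d *s e j"
    have xy: "B x y = 0" "B y x = 0" "Q x = 2" "Q y = 2"
      using orth \<open>i \<noteq> j\<close> cd
      by (auto simp: x_def y_def B_scale_left B_scale_right orthogonal_family_def)
    have other: "B x (e l) = 0" "B y (e l) = 0" "B (e l) x = 0" "B (e l) y = 0"
      if "l \<noteq> i" "l \<noteq> j" for l
      using orth that by (auto simp: x_def y_def B_scale_left B_scale_right orthogonal_family_def)
    (* Over F_5 the form 2 X^2 + 2 Y^2 is equivalent to X^2 + Y^2. *)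
    define e' where "e' = e(i := 2 *s x + 2 *s y, j := 2 *s x - 2 *s y)"
    have Q': "Q (2 *s x + 2 *s y) = 1" "Q (2 *s x - 2 *s y) = 1"
      by (simp_all add: Q_add Q_diff Q_scale B_scale_left B_scale_right xy numeral_eq_iff5)
    have B': "B (2 *s x + 2 *s y) (2 *s x - 2 *s y) = 0" "B (2 *s x - 2 *s y) (2 *s x + 2 *s y) = 0"
      by (simp_all add: B_add_left B_add_right B_diff_left B_diff_right B_scale_left
          B_scale_right xy B_self)
    have "orthogonal_family UNIV e'"
      using orth Q' B' other unfolding orthogonal_family_def e'_def
      by (auto simp: B_add_left B_add_right B_diff_left B_diff_right B_scale_left B_scale_right
          xy B_self)
    moreover have "{i. Q (e i) = 1} \<subset> {i. Q (e' i) = 1}"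
      using ij Q' by (auto simp: e'_def)
    ultimately show False
      using max by blast
  qed
  show ?thesis
    using orth unique by blast
qed

lemma Q_orthogonal_sum:
  assumes "orthogonal_family I e"
  shows "Q (\<Sum>i\<in>I. c i *s e i) = (\<Sum>i\<in>I. (c i)\<^sup>2 * Q (e i))"
proof -
  have "B (\<Sum>i\<in>I. c i *s e i) (\<Sum>i\<in>I. c i *s e i) = (\<Sum>i\<in>I. c i * B (\<Sum>i\<in>I. c i *s e i) (e i))"
    by (simp only: B_sum_right[OF finite] B_scale_right)
  also have "\<dots> = (\<Sum>i\<in>I. (c i)\<^sup>2 * Q (e i))"
  proof (intro sum.cong refl)
    fix i assume "i \<in> I"
    hence "B (\<Sum>i\<in>I. c i *s e i) (e i) = c i * Q (e i)"
      using orthogonal_family_B_sum[OF assms] B_commute by metis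
    thus "c i * B (\<Sum>i\<in>I. c i *s e i) (e i) = (c i)\<^sup>2 * Q (e i)"
      by (simp add: power2_eq_square)
  qed
  finally show ?thesis
    by (simp add: B_self)
qed

text \<open>This is what guarantees that the SOME in \<open>form_det\<close> returns a determinant.
  The change of coordinates T has the almost orthonormal basis as its columns, and d is the value of
  Q at the exceptional basis vector.\<close>

lemma normal_form_exists:
  "\<exists>d. d \<noteq> 0 \<and> (\<exists>k. equivalent_forms Q (normal_form k d))"
proof -
  obtain e k where orth: "orthogonal_family UNIV e" and one: "\<And>i. i \<noteq> k \<Longrightarrow> Q (e i) = 1"
    using almost_orthonormal_basis_exists by blast
  define T :: "'f ^ 'n ^ 'n" where "T = (\<chi> r c. e c $ r)"
  have T: "T *v x = (\<Sum>i\<in>UNIV. x $ i *s e i)" for x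
    by (simp add: T_def matrix_vector_mult_def vec_eq_iff sum_component mult.commute)
  have "x = y" if "T *v x = T *v y" for x y
  proof -
    have "x $ j = y $ j" for j
    proof -
      have "x $ j * Q (e j) = y $ j * Q (e j)"
        using arg_cong[OF that, of "B (e j)"] orthogonal_family_B_sum[OF orth] by (simp add: T)
      thus ?thesis
        using orth by (simp add: orthogonal_family_def)
    qed
    thus ?thesis by (simp add: vec_eq_iff)
  qed
  hence "inj ((*v) T)"
    by (auto simp: inj_def)
  hence "\<exists>T'. T' ** T = mat 1"
    by (simp add: matrix_left_invertible_injective)
  hence inv: "invertible T"
    using matrix_left_right_inverse unfolding invertible_def by blast
  have "normal_form k (Q (e k)) x = Q (T *v x)" for x
  proof -
    have "Q (T *v x) = (\<Sum>i\<in>UNIV. (x $ i)\<^sup>2 * Q (e i))"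
      unfolding T by (rule Q_orthogonal_sum[OF orth])
    also have "\<dots> = (\<Sum>i\<in>UNIV - {k}. (x $ i)\<^sup>2 * Q (e i)) + (x $ k)\<^sup>2 * Q (e k)"
      by (simp add: sum.remove[of UNIV k] add.commute)
    also have "\<dots> = normal_form k (Q (e k)) x"
      using one by (simp add: normal_form_def)
    finally show ?thesis ..
  qed
  with inv have "equivalent_forms Q (normal_form k (Q (e k)))"
    unfolding equivalent_forms_def by blast
  moreover have "Q (e k) \<noteq> 0"
    using orth by (simp add: orthogonal_family_def)
  ultimately show ?thesis by blast
qed

lemma form_det: "form_det Q \<noteq> 0" "\<exists>k. equivalent_forms Q (normal_form k (form_det Q))"
  using someI_ex[OF normal_form_exists] unfolding form_det_def by blast+

end

section \<open>Counting points on sections of the quadric\<close>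

text \<open>The distributive law for sums over all functions, carried over to vectors; it splits the
  Gauss sum of a diagonal form into sums in one variable.\<close>

lemma sum_prod_vec:
  fixes h :: "'n::finite \<Rightarrow> 'a::finite \<Rightarrow> 'c::comm_semiring_1"
  shows "(\<Sum>x\<in>UNIV. \<Prod>i\<in>UNIV. h i (x $ i)) = (\<Prod>i\<in>UNIV. \<Sum>y\<in>UNIV. h i y)"
proof -
  have "bij (vec_nth :: 'a ^ 'n \<Rightarrow> 'n \<Rightarrow> 'a)"
    by (rule bij_betw_byWitness[of _ vec_lambda]) (auto simp: vec_lambda_eta)
  hence "(\<Sum>x\<in>UNIV. \<Prod>i\<in>UNIV. h i (x $ i)) = (\<Sum>g\<in>UNIV. \<Prod>i\<in>UNIV. h i (g i))"
    by (rule sum.reindex_bij_betw[where h = vec_nth])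
  also have "\<dots> = (\<Prod>i\<in>UNIV. \<Sum>y\<in>UNIV. h i y)"
    using prod_sum_PiE[of UNIV "\<lambda>_. UNIV" h] by (simp add: PiE_UNIV_domain)
  finally show ?thesis .
qed

lemma bij_betw_add_subgroup:
  fixes a :: "'a::group_add"
  assumes "finite A" "\<And>x y. x \<in> A \<Longrightarrow> y \<in> A \<Longrightarrow> x + y \<in> A" "a \<in> A"
  shows "bij_betw (\<lambda>x. a + x) A A"
proof -
  have "inj_on (\<lambda>x. a + x) A" "(\<lambda>x. a + x) ` A \<subseteq> A"
    using assms by (auto simp: inj_on_def)
  thus ?thesis
    using endo_inj_surj[OF assms(1)] by (simp add: bij_betw_def)
qed

context form5
begin

text \<open>Translation by an a with \<open>g a\<close> nonzero permutes A and multiplies the sum by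
  \<open>psi5 (g a)\<close>, which is not 1.\<close>

lemma character_sum:
  fixes g :: "'g::ab_group_add \<Rightarrow> 'f"
  assumes "finite A" "\<And>x y. x \<in> A \<Longrightarrow> y \<in> A \<Longrightarrow> x + y \<in> A"
    and "\<And>x y. g (x + y) = g x + g y"
  shows "(\<Sum>x\<in>A. psi5 (g x)) = (if \<forall>x\<in>A. g x = 0 then of_nat (card A) else 0)"
proof (cases "\<forall>x\<in>A. g x = 0")
  case True
  thus ?thesis by (simp add: psi5_numeral)
next
  case False
  then obtain a where a: "a \<in> A" "g a \<noteq> 0" by blast
  have "(\<Sum>x\<in>A. psi5 (g x)) = (\<Sum>x\<in>A. psi5 (g (a + x)))"
    by (rule sum.reindex_bij_betw[symmetric, OF bij_betw_add_subgroup])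
      (use assms a in auto)
  also have "\<dots> = psi5 (g a) * (\<Sum>x\<in>A. psi5 (g x))"
    by (simp add: assms(3) psi5_add sum_distrib_left)
  finally have "(1 - psi5 (g a)) * (\<Sum>x\<in>A. psi5 (g x)) = 0"
    by (simp add: algebra_simps)
  thus ?thesis
    using a(2) False by (auto simp: psi5_eq_1_iff)
qed

text \<open>In diagonal coordinates the sum is a product of n sums in one variable. The n - 1
  factors with coefficient 1 are equal and, n - 1 being even, multiply to a power of
  \<open>gauss5\<close> squared = 5; the factor at k contributes mu(t det Q) and the last
  \<open>gauss5\<close>.\<close>

lemma gauss_sum_form:
  assumes "odd CARD('n)" "t \<noteq> 0"
  shows "(\<Sum>x\<in>UNIV. psi5 (t * Q x)) =
    of_int (quadratic_character t * quadratic_character (form_det Q)) *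
      5 ^ ((CARD('n) - 1) div 2) * gauss5"
proof -
  obtain k and T :: "'f ^ 'n ^ 'n" where T: "invertible T" "\<And>x. normal_form k (form_det Q) x = Q (T *v x)"
    using form_det(2) unfolding equivalent_forms_def by metis
  define c where "c i = (if i = k then form_det Q else 1)" for i
  have c: "Q (T *v x) = (\<Sum>i\<in>UNIV. c i * (x $ i)\<^sup>2)" for x
  proof -
    have "(\<Sum>i\<in>UNIV. c i * (x $ i)\<^sup>2) = (\<Sum>i\<in>UNIV - {k}. c i * (x $ i)\<^sup>2) + c k * (x $ k)\<^sup>2"
      by (simp add: sum.remove[of UNIV k] add.commute)
    also have "\<dots> = normal_form k (form_det Q) x"
      by (simp add: normal_form_def c_def)
    finally show ?thesis
      by (simp add: T(2))
  qed
  have "bij ((*v) T)"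
    using T(1) by (simp add: invertible_eq_bij)
  hence "(\<Sum>x\<in>UNIV. psi5 (t * Q x)) = (\<Sum>x\<in>UNIV. psi5 (t * Q (T *v x)))"
    by (rule sum.reindex_bij_betw[symmetric])
  also have "\<dots> = (\<Sum>x\<in>UNIV. \<Prod>i\<in>UNIV. psi5 (t * c i * (x $ i)\<^sup>2))"
    by (simp add: c sum_distrib_left psi5_sum mult.assoc)
  also have "\<dots> = (\<Prod>i\<in>UNIV. \<Sum>y\<in>UNIV. psi5 (t * c i * y\<^sup>2))"
    by (rule sum_prod_vec)
  also have "\<dots> = (\<Prod>i\<in>UNIV. of_int (quadratic_character (t * c i)) * gauss5)"
  proof -
    have "t * c i \<noteq> 0" for i
      using assms(2) form_det(1) by (simp add: c_def)
    thus ?thesis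
      by (simp only: gauss_sum_sq if_False)
  qed
  also have "\<dots> = (\<Prod>i\<in>UNIV - {k}. of_int (quadratic_character (t * c i)) * gauss5) *
      (of_int (quadratic_character (t * c k)) * gauss5)"
    by (simp add: prod.remove[of UNIV k] mult.commute)
  also have "(\<Prod>i\<in>UNIV - {k}. of_int (quadratic_character (t * c i)) * gauss5) =
      (of_int (quadratic_character t) * gauss5) ^ (CARD('n) - 1)"
    by (simp add: c_def card_Diff_singleton)
  also have "CARD('n) - 1 = 2 * ((CARD('n) - 1) div 2)"
    using assms(1) by simp
  also have "(of_int (quadratic_character t) * gauss5) ^ (2 * ((CARD('n) - 1) div 2)) =
      5 ^ ((CARD('n) - 1) div 2)"
  proof -
    have "(quadratic_character t)\<^sup>2 = 1"
      using assms(2) by (simp add: quadratic_character_def)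
    hence "(of_int (quadratic_character t) * gauss5)\<^sup>2 = 5"
      unfolding power_mult_distrib gauss5_sq by (metis mult_1 of_int_1 of_int_power)
    thus ?thesis
      by (simp add: power_mult)
  qed
  finally show ?thesis
    by (simp add: c_def qc_mult)
qed

(* Completing the square: 1/2 = -2 in F_5, so u is shifted by 2 x. *)
lemma gauss_sum_shift:
  "(\<Sum>u\<in>UNIV. psi5 (t * (Q u + B x u))) = psi5 (t * Q x) * (\<Sum>u\<in>UNIV. psi5 (t * Q u))"
proof -
  have "bij (\<lambda>u. 2 *s x + u)"
    by (rule bij_betw_add_subgroup) auto
  hence "(\<Sum>u\<in>UNIV. psi5 (t * (Q u + B x u))) =
      (\<Sum>u\<in>UNIV. psi5 (t * (Q (2 *s x + u) + B x (2 *s x + u))))"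
    by (rule sum.reindex_bij_betw[symmetric])
  also have "\<dots> = (\<Sum>u\<in>UNIV. psi5 (t * Q x) * psi5 (t * Q u))"
  proof (rule sum.cong[OF refl])
    fix u
    have "Q (2 *s x + u) + B x (2 *s x + u) = Q x + Q u + 5 * (Q x + B x u)"
      by (simp add: Q_add Q_scale B_scale_left B_add_right B_scale_right B_self B_commute[of u x] algebra_simps)
    also have "(5 :: 'f) = 0"
      by (simp add: numeral_eq_iff5)
    finally have "Q (2 *s x + u) + B x (2 *s x + u) = Q x + Q u"
      by simp
    thus "psi5 (t * (Q (2 *s x + u) + B x (2 *s x + u))) = psi5 (t * Q x) * psi5 (t * Q u)"
      by (simp only: distrib_left psi5_add)
  qed
  finally show ?thesis
    by (simp add: sum_distrib_left)
qed

text \<open>A pair (x, c) stands for the equation B x u = c, and the set is closed under linear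
  consequences. The last conjunct is consistency: the equation 0 = c occurs only for c = 0.\<close>

definition affine_system :: "(('f ^ 'n) \<times> 'f) set \<Rightarrow> bool" where
  "affine_system P \<longleftrightarrow>
     (0, 0) \<in> P \<and> (\<forall>p\<in>P. \<forall>q\<in>P. p + q \<in> P) \<and>
     (\<forall>x c t. (x, c) \<in> P \<longrightarrow> (t *s x, t * c) \<in> P) \<and> (\<forall>c. (0, c) \<in> P \<longrightarrow> c = 0)"

text \<open>The factors 5 and \<open>card P\<close> on the left are the values of the two
  orthogonality sums at a solution u: the sum over t detects Q u = 1, the sum over P detects the
  linear equations. The term t = 0 yields the main term 5 ^ n.\<close>

lemma quadric_section_card:
  assumes odd: "odd CARD('n)" and P: "affine_system P"
  shows "5 * int (card P) * int (card {u. Q u = 1 \<and> (\<forall>(x, c)\<in>P. B x u = c)}) =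
    5 ^ CARD('n) + quadratic_character (form_det Q) * 5 ^ ((CARD('n) + 1) div 2) *
      (\<Sum>(x, c)\<in>P. quadratic_character (Q x - c - 1))"
proof -
  define g where "g u = (\<lambda>(x, c). B x u - c)" for u
  define m where "m = (CARD('n) - 1) div 2"
  define d where "d = quadratic_character (form_det Q)"
  define S where "S = {u. Q u = 1 \<and> (\<forall>(x, c)\<in>P. B x u = c)}"
  define H where "H t = (\<Sum>u\<in>UNIV. \<Sum>p\<in>P. psi5 (t * (Q u - 1)) * psi5 (g u p))" for t
  have g_add: "g u (p + q) = g u p + g u q" for u p q
    by (cases p; cases q) (simp add: g_def B_add_left)
  have "finite P"
    by simp
  have P_add: "p + q \<in> P" if "p \<in> P" "q \<in> P" for p q
    using P that by (simp add: affine_system_def)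
  (* The sum over all t of H t detects both Q u = 1 and the affine conditions. *)
  have P_sum: "(\<Sum>p\<in>P. psi5 (g u p)) = (if \<forall>(x, c)\<in>P. B x u = c then of_nat (card P) else 0)" for u
  proof -
    have "(\<forall>p\<in>P. g u p = 0) \<longleftrightarrow> (\<forall>(x, c)\<in>P. B x u = c)"
      by (auto simp: g_def)
    thus ?thesis
      using character_sum[of P "g u"] g_add P_add by simp
  qed
  have "(\<Sum>t\<in>UNIV. H t) =
      (\<Sum>u\<in>UNIV. (\<Sum>t\<in>UNIV. psi5 (t * (Q u - 1))) * (\<Sum>p\<in>P. psi5 (g u p)))"
    unfolding H_def
    by (subst sum.swap) (simp add: sum_product)
  also have "\<dots> = (\<Sum>u\<in>UNIV. if u \<in> S then 5 * of_nat (card P) else 0)"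
    by (intro sum.cong refl) (auto simp: sum_psi5_mult P_sum S_def)
  also have "\<dots> = 5 * of_nat (card P) * of_nat (card S)"
    by (simp add: sum.If_cases)
  finally have lhs: "(\<Sum>t\<in>UNIV. H t) = 5 * of_nat (card P) * of_nat (card S)" .

  \<comment> \<open>By nondegeneracy the sum over u vanishes unless x = 0, and consistency then
    leaves only the pair (0, 0).\<close>
  have H0: "H 0 = 5 ^ CARD('n)"
  proof -
    have "H 0 = (\<Sum>p\<in>P. \<Sum>u\<in>UNIV. psi5 (g u p))"
      unfolding H_def by (subst sum.swap) (simp add: psi5_numeral)
    also have "\<dots> = (\<Sum>p\<in>P. if p = (0, 0) then 5 ^ CARD('n) else 0)"
    proof (rule sum.cong[OF refl])
      fix p assume "p \<in> P"
      obtain x c where p: "p = (x, c)" by (cases p)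
      have "(\<Sum>u\<in>UNIV. psi5 (g u p)) = psi5 (- c) * (\<Sum>u\<in>UNIV. psi5 (B x u))"
        using psi5_add[of "- c"] by (simp add: g_def p sum_distrib_left)
      also have "(\<Sum>u\<in>UNIV. psi5 (B x u)) = (if x = 0 then 5 ^ CARD('n) else 0)"
      proof -
        have "(\<forall>u\<in>UNIV. B x u = 0) \<longleftrightarrow> x = 0"
          using nondeg by (auto simp: nondegenerate_def)
        thus ?thesis
          using character_sum[of UNIV "B x"] by (simp add: B_add_right card_field)
      qed
      finally show "(\<Sum>u\<in>UNIV. psi5 (g u p)) = (if p = (0, 0) then 5 ^ CARD('n) else 0)"
        using P \<open>p \<in> P\<close> by (auto simp: p affine_system_def psi5_numeral)
    qed
    also have "\<dots> = 5 ^ CARD('n)"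
      using P by (simp add: affine_system_def)
    finally show ?thesis .
  qed

  have H1: "H t = of_int d * 5 ^ m * gauss5 *
      (\<Sum>(x, c)\<in>P. of_int (quadratic_character t) * psi5 (t * (Q x - c - 1)))" if "t \<noteq> 0" for t
  proof -
    \<comment> \<open>Reindexing P by multiplication with t turns B x u - c into t (B x u - c), so
      that t becomes a common factor of the quadratic and the linear part.\<close>
    have bij: "bij_betw (\<lambda>(x, c). (t *s x, t * c)) P P"
    proof -
      have "inj_on (\<lambda>(x, c). (t *s x, t * c)) P"
        using that by (auto simp: inj_on_def)
      moreover have "(\<lambda>(x, c). (t *s x, t * c)) ` P \<subseteq> P"
        using P by (auto simp: affine_system_def)
      ultimately show ?thesis
        using endo_inj_surj[OF \<open>finite P\<close>] by (simp add: bij_betw_def)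
    qed
    have "H t = (\<Sum>u\<in>UNIV. \<Sum>(x, c)\<in>P. psi5 (t * (Q u - 1)) * psi5 (t * (B x u - c)))"
      unfolding H_def
      by (subst sum.reindex_bij_betw[OF bij, symmetric])
        (simp add: g_def B_scale_left case_prod_beta right_diff_distrib)
    also have "\<dots> = (\<Sum>(x, c)\<in>P. \<Sum>u\<in>UNIV. psi5 (t * (Q u - 1)) * psi5 (t * (B x u - c)))"
      by (subst sum.swap) (simp add: case_prod_beta)
    also have "\<dots> = (\<Sum>(x, c)\<in>P. psi5 (t * (- c - 1)) * (\<Sum>u\<in>UNIV. psi5 (t * (Q u + B x u))))"
      by (simp add: psi5_add[symmetric] sum_distrib_left algebra_simps)
    also have "\<dots> = (\<Sum>(x, c)\<in>P. of_int d * 5 ^ m * gauss5 *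
        (of_int (quadratic_character t) * psi5 (t * (Q x - c - 1))))"
    proof (rule sum.cong[OF refl], clarify)
      fix x c
      have "psi5 (t * (Q x - c - 1)) = psi5 (t * (- c - 1)) * psi5 (t * Q x)"
        by (simp add: psi5_add[symmetric] algebra_simps)
      thus "psi5 (t * (- c - 1)) * (\<Sum>u\<in>UNIV. psi5 (t * (Q u + B x u))) =
          of_int d * 5 ^ m * gauss5 *
            (of_int (quadratic_character t) * psi5 (t * (Q x - c - 1)))"
        by (simp add: gauss_sum_shift gauss_sum_form[OF odd that] d_def m_def)
    qed
    finally show ?thesis
      by (simp add: sum_distrib_left case_prod_beta)
  qed
  have "(\<Sum>t\<in>UNIV. H t) = H 0 + (\<Sum>t\<in>UNIV - {0}. H t)"
    by (rule sum.remove) auto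
  also have "(\<Sum>t\<in>UNIV - {0}. H t) = (\<Sum>t\<in>UNIV - {0}. of_int d * 5 ^ m * gauss5 *
      (\<Sum>(x, c)\<in>P. of_int (quadratic_character t) * psi5 (t * (Q x - c - 1))))"
    using H1 by (intro sum.cong) auto
  \<comment> \<open>The term t = 0 can be put back because mu(0) = 0; this completes the sum to a
    full Gauss sum of mu.\<close>
  also have "\<dots> = (\<Sum>t\<in>UNIV. of_int d * 5 ^ m * gauss5 *
      (\<Sum>(x, c)\<in>P. of_int (quadratic_character t) * psi5 (t * (Q x - c - 1))))"
    by (rule sum.mono_neutral_left) (auto simp: qc_numeral case_prod_beta)
  also have "\<dots> = of_int d * 5 ^ m * gauss5 *
      (\<Sum>(x, c)\<in>P. \<Sum>t\<in>UNIV. of_int (quadratic_character t) * psi5 (t * (Q x - c - 1)))"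
    unfolding sum_distrib_left[symmetric] by (subst sum.swap) (simp add: case_prod_beta)
  also have "\<dots> = of_int d * 5 ^ m * gauss5 *
      (\<Sum>(x, c)\<in>P. of_int (quadratic_character (Q x - c - 1)) * gauss5)"
    unfolding gauss_sum_qc ..
  also have "\<dots> = of_int d * 5 ^ m * gauss5\<^sup>2 *
      (\<Sum>(x, c)\<in>P. of_int (quadratic_character (Q x - c - 1)))"
    by (simp add: sum_distrib_right[symmetric] case_prod_beta power2_eq_square)
  also have "\<dots> = of_int (d * 5 ^ (m + 1) * (\<Sum>(x, c)\<in>P. quadratic_character (Q x - c - 1)))"
    unfolding gauss5_sq by (simp add: case_prod_beta)
  also have "m + 1 = (CARD('n) + 1) div 2"
    using odd by (auto simp: m_def elim: oddE)
  finally have "(of_int (5 * int (card P) * int (card S)) :: complex) =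
      of_int (5 ^ CARD('n) + d * 5 ^ ((CARD('n) + 1) div 2) *
        (\<Sum>(x, c)\<in>P. quadratic_character (Q x - c - 1)))"
    unfolding lhs H0 by simp
  thus ?thesis
    unfolding of_int_eq_iff d_def S_def .
qed


text \<open>Independence of v and w makes the equations B v u = c and B w u = d consistent for all c
  and d, and keeps their linear combinations distinct.\<close>

lemma affine_system_span2:
  assumes "\<And>r s. r *s v + s *s w = 0 \<Longrightarrow> r = 0 \<and> s = 0"
  shows "affine_system ((\<lambda>(r, s). (r *s v + s *s w, r * c + s * d)) ` UNIV)" (is "affine_system (?h ` _)")
    and "inj (\<lambda>(r, s). (r *s v + s *s w, r * c + s * d))"
proof -
  have "p + q \<in> range ?h" if "p \<in> range ?h" "q \<in> range ?h" for p q
  proof -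
    obtain r s r' s' where "p = ?h (r, s)" "q = ?h (r', s')"
      using \<open>p \<in> range ?h\<close> \<open>q \<in> range ?h\<close> by auto
    hence "p + q = ?h (r + r', s + s')"
      by (simp add: vec.scale_left_distrib distrib_right)
    thus ?thesis by blast
  qed
  moreover have "(0, 0) \<in> range ?h"
    by (rule image_eqI[of _ _ "(0, 0)"]) (auto simp: vec_eq_iff)
  moreover have "(t *s x, t * e) \<in> range ?h" if "(x, e) \<in> range ?h" for x e t
  proof -
    obtain r s where "x = r *s v + s *s w" "e = r * c + s * d"
      using \<open>(x, e) \<in> range ?h\<close> by auto
    thus ?thesis
      by (intro image_eqI[of _ _ "(t * r, t * s)"]) (auto simp: vec.scale_right_distrib mult.assoc distrib_left)
  qed
  moreover have "e = 0" if "(0, e) \<in> range ?h" for e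
  proof -
    obtain r s where "0 = r *s v + s *s w" "e = r * c + s * d"
      using \<open>(0, e) \<in> range ?h\<close> by auto
    thus ?thesis
      using assms[of r s] by simp
  qed
  ultimately show "affine_system (range ?h)"
    unfolding affine_system_def by blast
  show "inj ?h"
  proof (rule injI, clarify)
    fix r s r' s'
    assume "r *s v + s *s w = r' *s v + s' *s w"
    moreover have "(r - r') *s v + (s - s') *s w = (r *s v + s *s w) - (r' *s v + s' *s w)"
      by (simp only: vec.scale_left_diff_distrib add_diff_add)
    ultimately have "(r - r') *s v + (s - s') *s w = 0"
      by simp
    thus "r = r' \<and> s = s'"
      using assms[of "r - r'" "s - s'"] by simp
  qed
qed

section \<open>Sizes of the quadric and of its sections by one or two linear equations\<close>

lemma card_quadric:
  assumes "CARD('n) = 2 * j + 5"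
  shows "int (card {u. Q u = 1}) = 5 ^ (2 * j + 4) + quadratic_character (form_det Q) * 5 ^ (j + 2)"
proof -
  have "affine_system {(0, 0)}"
    by (simp add: affine_system_def zero_prod_def)
  \<comment> \<open>The system is trivial and its character sum is mu(-1) = 1. For n = 2 * j + 5 the
    exponent (n + 1) / 2 is j + 3, and one factor 5 cancels.\<close>
  from quadric_section_card[OF _ this] assms show ?thesis
    by (simp add: qc_numeral power_add)
qed

lemma card_quadric_section:
  assumes "CARD('n) = 2 * j + 5" "Q v = 1"
  shows "int (card {u. Q u = 1 \<and> B v u = c}) =
    5 ^ (2 * j + 3) + quadratic_character (form_det Q) * 5 ^ (j + 1) *
      (\<Sum>r\<in>UNIV. quadratic_character (r\<^sup>2 - r * c - 1))"
proof -
  \<comment> \<open>The system is the line spanned by (v, c); its 5 elements together with the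
    factor 5 of \<open>quadric_section_card\<close> cancel 5^2 from the right-hand side.\<close>
  define h where "h r = (r *s v, r * c)" for r
  have "v \<noteq> 0"
    using assms(2) by auto
  hence inj: "inj h"
    by (auto simp: inj_def h_def)
  have "affine_system (range h)"
    unfolding affine_system_def
  proof (intro conjI ballI allI impI)
    show "(0, 0) \<in> range h"
      by (rule image_eqI[of _ _ 0]) (auto simp: h_def)
    fix p q assume "p \<in> range h" "q \<in> range h"
    then obtain r s where "p = h r" "q = h s" by blast
    thus "p + q \<in> range h"
      by (intro image_eqI[of _ _ "r + s"]) (auto simp: h_def vec.scale_left_distrib distrib_right)
  next
    fix x e t assume "(x, e) \<in> range h"
    then obtain r where "(x, e) = h r" by blast
    thus "(t *s x, t * e) \<in> range h"
      by (intro image_eqI[of _ _ "t * r"]) (auto simp: h_def mult.assoc)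
  next
    fix e assume "(0, e) \<in> range h"
    thus "e = 0"
      using \<open>v \<noteq> 0\<close> by (auto simp: h_def)
  qed
  moreover have "(\<forall>(x, e)\<in>range h. B x u = e) \<longleftrightarrow> B v u = c" for u
    by (auto simp: h_def B_scale_left dest: spec[of _ 1])
  moreover have "card (range h) = 5"
    using inj by (simp add: card_image card_field)
  moreover have "(\<Sum>(x, e)\<in>range h. quadratic_character (Q x - e - 1)) =
      (\<Sum>r\<in>UNIV. quadratic_character (r\<^sup>2 - r * c - 1))"
    by (subst sum.reindex[OF inj]) (simp add: h_def Q_scale assms(2))
  ultimately show ?thesis
    using quadric_section_card[of "range h"] assms(1) by (simp add: power_add)
qed

text \<open>If w = t v, then comparing the values of Q gives t^2 = 1, so w is v or - v.\<close>

lemma independent_if_distinct_points: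
  assumes "Q v = 1" "Q w = 1" "w \<noteq> v" "w \<noteq> - v" "r *s v + s *s w = 0"
  shows "r = 0 \<and> s = 0"
proof (cases "s = 0")
  case True
  moreover have "v \<noteq> 0"
    using assms(1) by auto
  ultimately show ?thesis
    using assms(5) by auto
next
  case False
  define t where "t = - r / s"
  have "w = t *s v"
  proof -
    have "s * w $ i = - (r * v $ i)" for i
      using arg_cong[OF assms(5), of "\<lambda>z. z $ i"] by (simp add: eq_neg_iff_add_eq_0 add.commute)
    thus ?thesis
      using False by (simp add: t_def vec_eq_iff field_simps)
  qed
  moreover from this have "t\<^sup>2 = 1"
    using assms(1,2) by (simp add: Q_scale)
  hence "t = 1 \<or> t = - 1"
    by (simp add: power2_eq_1_iff)
  ultimately show ?thesis
    using assms(3,4) by (auto simp: vec_minus_eq_scale[symmetric])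
qed

text \<open>For Q v = Q w = 1 and B v w = b the argument of the character is Q x - e - 1 with x = r
  v + s w and e = r c + s d.\<close>

definition plane_sum :: "'f \<Rightarrow> 'f \<Rightarrow> 'f \<Rightarrow> int" where
  "plane_sum b c d =
     (\<Sum>r\<in>UNIV. \<Sum>s\<in>UNIV. quadratic_character (r\<^sup>2 + s\<^sup>2 + 2 * r * s * b - r * c - s * d - 1))"

text \<open>The system is spanned by (v, c) and (w, d) and has 25 elements, so 5^3 cancels.\<close>

lemma card_quadric_section2:
  assumes "CARD('n) = 2 * j + 5" "Q v = 1" "Q w = 1" "w \<noteq> v" "w \<noteq> - v"
  shows "int (card {u. Q u = 1 \<and> B v u = c \<and> B w u = d}) =
    5 ^ (2 * j + 2) + quadratic_character (form_det Q) * 5 ^ j * plane_sum (B v w) c d"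
proof -
  define h where "h = (\<lambda>(r, s). (r *s v + s *s w, r * c + s * d))"
  have ind: "r = 0 \<and> s = 0" if "r *s v + s *s w = 0" for r s
    by (rule independent_if_distinct_points[OF assms(2-5) that])
  have sys: "affine_system (range h)"
    unfolding h_def by (rule affine_system_span2(1), rule ind)
  have inj: "inj h"
    unfolding h_def by (rule affine_system_span2(2), rule ind)
  have mem_iff: "(\<forall>(x, e)\<in>range h. B x u = e) \<longleftrightarrow> B v u = c \<and> B w u = d" for u
  proof
    assume *: "\<forall>(x, e)\<in>range h. B x u = e"
    have "(v, c) \<in> range h"
      by (rule image_eqI[of _ _ "(1, 0)"]) (auto simp: h_def)
    moreover have "(w, d) \<in> range h"
      by (rule image_eqI[of _ _ "(0, 1)"]) (auto simp: h_def)
    ultimately show "B v u = c \<and> B w u = d"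
      using bspec[OF *, of "(v, c)"] bspec[OF *, of "(w, d)"] by simp
  qed (auto simp: h_def B_add_left B_scale_left)
  have card_h: "card (range h) = 25"
    using card_image[OF inj] card_cartesian_product[of "UNIV :: 'f set" "UNIV :: 'f set"]
    by (simp add: card_field)
  have sum_h: "(\<Sum>(x, e)\<in>range h. quadratic_character (Q x - e - 1)) = plane_sum (B v w) c d"
    unfolding plane_sum_def sum.cartesian_product UNIV_Times_UNIV
    by (subst sum.reindex[OF inj], intro sum.cong)
      (auto simp: h_def Q_add Q_scale B_scale_left B_scale_right assms algebra_simps)
  have "odd CARD('n)"
    using assms(1) by simp
  from quadric_section_card[OF this sys] show ?thesis
    unfolding mem_iff card_h sum_h assms(1) by (simp add: power_add)
qed

text \<open>The discriminant c^2 + 4 is nonzero for these c, and then the values of mu at a monic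
  quadratic polynomial add up to -1. For c = 1 or 4 the polynomial is a square and the sum would be
  4.\<close>

lemma line_sum:
  "c \<in> {0, 2, 3} \<Longrightarrow> (\<Sum>r\<in>UNIV. quadratic_character (r\<^sup>2 - r * c - 1 :: 'f)) = -1"
  by (auto simp: sum_field qc_numeral chi5_def)

text \<open>The plane is hyperbolic for b = 0, degenerate for b = 1, 4 and anisotropic for b = 2, 3.
  A hyperbolic plane takes the value 0 nine times and each other value four times, an anisotropic
  one once and six times; in the degenerate case the sum is 5 times that of mu(x^2 - 1). The last
  two types agree.\<close>

lemma plane_sum_0_0: "plane_sum b 0 0 = (if b = 0 then 5 else -5)"
proof -
  note [simp] = plane_sum_def sum_field qc_numeral numeral_eq_iff5 chi5_def
  consider "b = 0" | "b = 1" | "b = 2" | "b = 3" | "b = 4"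
    using field_cases5[of b] by blast
  thus ?thesis
    by cases simp_all
qed

text \<open>For b = 0 each summand is -5. For every other b two summands are -5 and two are 0: which
  ones, those with c = d or those with c different from d, depends on b, but the total does
  not.\<close>

lemma plane_sum_2_2:
  "plane_sum b 2 2 + plane_sum b 2 3 + plane_sum b 3 2 + plane_sum b 3 3 =
    (if b = 0 then -20 else -10)"
proof -
  note [simp] = plane_sum_def sum_field qc_numeral numeral_eq_iff5 chi5_def
  consider "b = 0" | "b = 1" | "b = 2" | "b = 3" | "b = 4"
    using field_cases5[of b] by blast
  thus ?thesis
    by cases simp_all
qed

end

section \<open>The graphs\<close>

text \<open>Inclusion-exclusion for the two neighbourhoods. The points u and v lie outside the union
  of the neighbourhoods exactly when they are not adjacent, which accounts for the -2 in only one of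
  the parameters.\<close>

lemma complement_strongly_regular:
  assumes "strongly_regular G N k l m"
  shows "strongly_regular (complement_graph G) N (N - k - 1) (N - 2 - 2 * k + m) (N - 2 * k + l)"
proof -
  let ?V = "pverts G" and ?H = "complement_graph G"
  interpret pair_graph G
    using assms by (simp add: strongly_regular_def)
  have N: "real (card ?V) = N" and k: "\<And>v. v \<in> ?V \<Longrightarrow> real (card (nbrs G v)) = k"
    and l: "\<And>u v. (u, v) \<in> parcs G \<Longrightarrow> real (common_nbrs G u v) = l"
    and m: "\<And>u v. \<lbrakk>u \<in> ?V; v \<in> ?V; u \<noteq> v; (u, v) \<notin> parcs G\<rbrakk> \<Longrightarrow> real (common_nbrs G u v) = m"
    using assms by (auto simp: strongly_regular_def regular_def)
  have fin: "finite ?V"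
    by (rule pair_finite_verts)
  have sub: "nbrs G v \<subseteq> ?V" and irr: "v \<notin> nbrs G v" for v
    using in_arcsD2 no_loops' by (auto simp: nbrs_def)
  have sym: "(v, u) \<in> parcs G" if "(u, v) \<in> parcs G" for u v
    using that pair_sym_arcs by (auto simp: symmetric_def sym_def)
  have fin_nbrs [simp]: "finite (nbrs G v)" for v
    using sub fin by (rule finite_subset)
  have nbrs: "nbrs ?H v = ?V - insert v (nbrs G v)" if "v \<in> ?V" for v
    using that by (auto simp: nbrs_def complement_graph_def)
  have graph: "pair_graph ?H"
    using fin sym
    by unfold_locales
      (auto simp: complement_graph_def symmetric_def sym_def intro: finite_subset[of _ "?V \<times> ?V"])
  have union: "real (card (nbrs G u \<union> nbrs G v)) = 2 * k - real (common_nbrs G u v)"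
    if "u \<in> ?V" "v \<in> ?V" for u v
    using card_Un_Int[of "nbrs G u" "nbrs G v"] k[OF that(1)] k[OF that(2)]
    by (simp add: common_nbrs_def)
  have common: "real (common_nbrs ?H u v) = N - real (card ({u, v} \<union> (nbrs G u \<union> nbrs G v)))"
    if "u \<in> ?V" "v \<in> ?V" for u v
  proof -
    have "nbrs ?H u \<inter> nbrs ?H v = ?V - ({u, v} \<union> (nbrs G u \<union> nbrs G v))"
      using that by (auto simp: nbrs)
    moreover have sub': "{u, v} \<union> (nbrs G u \<union> nbrs G v) \<subseteq> ?V"
      using that sub by blast
    ultimately show ?thesis
      using card_mono[OF fin sub'] card_Diff_subset[OF finite_subset[OF sub' fin] sub']
      by (simp add: common_nbrs_def N[symmetric] of_nat_diff)
  qed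
  have "real (card (nbrs ?H v)) = N - k - 1" if "v \<in> ?V" for v
  proof -
    have sub': "insert v (nbrs G v) \<subseteq> ?V"
      using that sub by blast
    show ?thesis
      using card_mono[OF fin sub'] card_Diff_subset[OF finite_subset[OF sub' fin] sub'] irr[of v]
        k[OF that]
      by (simp add: nbrs[OF that] N[symmetric] of_nat_diff)
  qed
  moreover have "real (common_nbrs ?H u v) = N - 2 - 2 * k + m"
    if "u \<in> ?V" "v \<in> ?V" "u \<noteq> v" "(u, v) \<notin> parcs G" for u v
  proof -
    have "{u, v} \<inter> (nbrs G u \<union> nbrs G v) = {}"
      using that irr sym by (auto simp: nbrs_def)
    hence "card ({u, v} \<union> (nbrs G u \<union> nbrs G v)) = 2 + card (nbrs G u \<union> nbrs G v)"
      using that(3) by (subst card_Un_disjoint) auto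
    thus ?thesis
      using that by (simp add: common union m)
  qed
  moreover have "real (common_nbrs ?H u v) = N - 2 * k + l"
    if "u \<in> ?V" "v \<in> ?V" "(u, v) \<in> parcs G" for u v
  proof -
    have "{u, v} \<union> (nbrs G u \<union> nbrs G v) = nbrs G u \<union> nbrs G v"
      using that sym by (auto simp: nbrs_def)
    thus ?thesis
      using that by (simp add: common union l)
  qed
  ultimately show ?thesis
    using graph N unfolding strongly_regular_def regular_def
    by (auto simp: complement_graph_def)
qed

section \<open>Pairs {v, -v}\<close>

definition sign_class :: "'a::uminus \<Rightarrow> 'a set" where
  "sign_class v = {v, - v}"

lemma sign_class_eq_iff: "sign_class u = sign_class v \<longleftrightarrow> u = v \<or> u = - (v :: 'a::group_add)"
  by (auto simp: sign_class_def doubleton_eq_iff)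

lemma card_sign_classes:
  fixes X :: "'a::group_add set"
  assumes "finite X" "\<And>x. x \<in> X \<Longrightarrow> - x \<in> X" "\<And>x. x \<in> X \<Longrightarrow> - x \<noteq> x"
  shows "2 * card (sign_class ` X) = card X"
proof -
  have un: "\<Union> (sign_class ` X) = X"
    using assms(2) by (auto simp: sign_class_def)
  have "2 * card (sign_class ` X) = card (\<Union> (sign_class ` X))"
  proof (rule card_partition)
    show "card c = 2" if c: "c \<in> sign_class ` X" for c
    proof -
      obtain x where "x \<in> X" "c = {x, - x}"
        using c by (auto simp: sign_class_def)
      thus ?thesis
        using assms(3)[of x] by (simp add: card_insert_if eq_commute[of x])
    qed
    show "c \<inter> c' = {}" if "c \<in> sign_class ` X" "c' \<in> sign_class ` X" "c \<noteq> c'" for c c'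
      using that by (auto simp: sign_class_def)
  qed (use assms(1) un in auto)
  thus ?thesis
    by (simp add: un)
qed

context form5
begin

lemma S_plus_eq: "S_plus Q = sign_class ` {v. Q v = 1}"
  by (auto simp: S_plus_def sign_class_def)

definition product_graph :: "'f set \<Rightarrow> ('f ^ 'n) set pair_pre_digraph" where
  "product_graph C = \<lparr>pverts = S_plus Q,
     parcs = {(sign_class v, sign_class u) | v u. Q v = 1 \<and> Q u = 1 \<and> B v u \<in> C}\<rparr>"

lemma minus_neq: "- x \<noteq> x" if "x \<noteq> 0" for x :: "'f ^ 'n"
proof
  assume *: "- x = x"
  have "x $ i = 0" for i
  proof -
    have "2 * x $ i = 0"
      using arg_cong[OF *, of "\<lambda>y. y $ i"] unfolding mult_2
      by (simp only: neg_eq_iff_add_eq_0 vector_uminus_component)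
    thus ?thesis
      using two_nonzero by simp
  qed
  thus False
    using that by (simp add: vec_eq_iff)
qed

lemma card_quadric_sign_classes:
  assumes "\<And>x. P x \<Longrightarrow> P (- x)"
  shows "2 * card (sign_class ` {u. Q u = 1 \<and> P u}) = card {u. Q u = 1 \<and> P u}"
proof (rule card_sign_classes)
  show "- x \<noteq> x" if "x \<in> {u. Q u = 1 \<and> P u}" for x
    using that by (intro minus_neq) auto
qed (use assms in auto)

section \<open>Graphs on pairs {v, -v} given by a symmetric set of values of B\<close>

context
  fixes C :: "'f set"
  assumes C: "\<And>c. c \<in> C \<Longrightarrow> - c \<in> C" "1 \<notin> C"
begin

lemma minus_mem_iff: "- c \<in> C \<longleftrightarrow> c \<in> C"
  using C(1)[of c] C(1)[of "- c"] by auto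

text \<open>Changing a representative changes at most the sign of B, and C is closed under
  signs.\<close>

lemma product_graph_arc_iff:
  assumes "Q v = 1" "Q u = 1"
  shows "(sign_class v, sign_class u) \<in> parcs (product_graph C) \<longleftrightarrow> B v u \<in> C"
proof
  assume "(sign_class v, sign_class u) \<in> parcs (product_graph C)"
  then obtain v' u' where "sign_class v = sign_class v'" "sign_class u = sign_class u'" "B v' u' \<in> C"
    by (auto simp: product_graph_def)
  thus "B v u \<in> C"
    by (auto simp: sign_class_eq_iff B_minus_left B_minus_right minus_mem_iff)
next
  assume "B v u \<in> C"
  thus "(sign_class v, sign_class u) \<in> parcs (product_graph C)"
    using assms unfolding product_graph_def by auto
qed

lemma nbrs_product_graph:
  assumes "Q v = 1"
  shows "nbrs (product_graph C) (sign_class v) = sign_class ` {u. Q u = 1 \<and> B v u \<in> C}"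
    (is "?L = ?R")
proof (intro equalityI subsetI)
  fix q assume q: "q \<in> ?L"
  then obtain u where u: "Q u = 1" "q = sign_class u"
    by (auto simp: nbrs_def product_graph_def)
  with q have "B v u \<in> C"
    using product_graph_arc_iff[OF assms u(1)] by (simp add: nbrs_def)
  with u show "q \<in> ?R"
    by blast
next
  fix q assume "q \<in> ?R"
  then obtain u where u: "Q u = 1" "B v u \<in> C" "q = sign_class u"
    by blast
  thus "q \<in> ?L"
    using product_graph_arc_iff[OF assms u(1)] by (simp add: nbrs_def)
qed

text \<open>Loops are excluded because B v v = Q v = 1 and B v (- v) = -1 are not in C.\<close>

lemma pair_graph_product_graph: "pair_graph (product_graph C)"
proof
  fix e assume e: "e \<in> parcs (product_graph C)"
  thus "fst e \<in> pverts (product_graph C)" "snd e \<in> pverts (product_graph C)"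
    by (auto simp: product_graph_def S_plus_eq)
  obtain v u where vu: "e = (sign_class v, sign_class u)" "Q v = 1" "Q u = 1" "B v u \<in> C"
    using e by (auto simp: product_graph_def)
  have "u \<noteq> v" "u \<noteq> - v"
    using vu C(2) minus_mem_iff[of 1] by (auto simp: B_self B_minus_right)
  thus "fst e \<noteq> snd e"
    using vu by (auto simp: sign_class_eq_iff)
next
  show "finite (pverts (product_graph C))"
    by (simp add: product_graph_def)
  show "finite (parcs (product_graph C))"
    by simp
  show "symmetric (product_graph C)"
    unfolding symmetric_def sym_def with_proj_simps
  proof (intro allI impI)
    fix p q assume "(p, q) \<in> parcs (product_graph C)"
    then obtain v u where "p = sign_class v" "q = sign_class u" "Q v = 1" "Q u = 1" "B v u \<in> C"
      by (auto simp: product_graph_def)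
    moreover from this have "B u v \<in> C"
      using B_commute[of u v] by simp
    ultimately show "(q, p) \<in> parcs (product_graph C)"
      unfolding product_graph_def by auto
  qed
qed

lemma card_nbrs_product_graph:
  assumes "Q v = 1"
  shows "2 * int (card (nbrs (product_graph C) (sign_class v))) =
    (\<Sum>c\<in>C. int (card {u. Q u = 1 \<and> B v u = c}))"
proof -
  have "2 * card (nbrs (product_graph C) (sign_class v)) = card {u. Q u = 1 \<and> B v u \<in> C}"
    unfolding nbrs_product_graph[OF assms]
    by (rule card_quadric_sign_classes) (simp add: B_minus_right minus_mem_iff)
  also have "{u. Q u = 1 \<and> B v u \<in> C} = (\<Union>c\<in>C. {u. Q u = 1 \<and> B v u = c})"
    by auto
  also have "card \<dots> = (\<Sum>c\<in>C. card {u. Q u = 1 \<and> B v u = c})"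
    by (rule card_UN_disjoint) auto
  finally have "int (2 * card (nbrs (product_graph C) (sign_class v))) =
      int (\<Sum>c\<in>C. card {u. Q u = 1 \<and> B v u = c})"
    by (rule arg_cong)
  thus ?thesis
    by simp
qed

lemma card_common_nbrs_product_graph:
  assumes "Q v = 1" "Q w = 1"
  shows "2 * int (common_nbrs (product_graph C) (sign_class v) (sign_class w)) =
    (\<Sum>c\<in>C. \<Sum>d\<in>C. int (card {u. Q u = 1 \<and> B v u = c \<and> B w u = d}))"
proof -
  \<comment> \<open>Forming classes commutes with this intersection because both sets of vectors are
    closed under negation.\<close>
  have "sign_class ` {u. Q u = 1 \<and> B v u \<in> C} \<inter> sign_class ` {u. Q u = 1 \<and> B w u \<in> C} =
      sign_class ` {u. Q u = 1 \<and> B v u \<in> C \<and> B w u \<in> C}"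
    by (auto simp: sign_class_eq_iff B_minus_right minus_mem_iff intro!: imageI)
  hence "2 * common_nbrs (product_graph C) (sign_class v) (sign_class w) =
      card {u. Q u = 1 \<and> B v u \<in> C \<and> B w u \<in> C}"
    unfolding common_nbrs_def nbrs_product_graph[OF assms(1)] nbrs_product_graph[OF assms(2)]
    by (simp add: card_quadric_sign_classes B_minus_right minus_mem_iff)
  also have "{u. Q u = 1 \<and> B v u \<in> C \<and> B w u \<in> C} =
      (\<Union>p\<in>C \<times> C. {u. Q u = 1 \<and> B v u = fst p \<and> B w u = snd p})"
    by auto
  also have "card \<dots> = (\<Sum>p\<in>C \<times> C. card {u. Q u = 1 \<and> B v u = fst p \<and> B w u = snd p})"
    by (rule card_UN_disjoint) auto
  also have "\<dots> = (\<Sum>c\<in>C. \<Sum>d\<in>C. card {u. Q u = 1 \<and> B v u = c \<and> B w u = d})"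
    by (simp add: sum.cartesian_product case_prod_beta)
  finally have "int (2 * common_nbrs (product_graph C) (sign_class v) (sign_class w)) =
      int (\<Sum>c\<in>C. \<Sum>d\<in>C. card {u. Q u = 1 \<and> B v u = c \<and> B w u = d})"
    by (rule arg_cong)
  thus ?thesis
    by simp
qed

end

section \<open>The relations R0, R1 and R2 as graphs\<close>

lemma minus_field: "- (2 :: 'f) = 3" "- (3 :: 'f) = 2" "- (1 :: 'f) = 4"
  by (simp_all add: numeral_eq_iff5)

lemma uminus_closed: "c \<in> {0} \<Longrightarrow> - c \<in> {0 :: 'f}" "c \<in> {2, 3} \<Longrightarrow> - c \<in> {2 :: 'f, 3}"
  by (auto simp: minus_field)

lemma not_one: "(1 :: 'f) \<notin> {0}" "(1 :: 'f) \<notin> {2, 3}"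
  using of_int_eq_iff5[of 1 0] by (simp_all add: numeral_eq_iff5)

lemma arc_iff:
  assumes "Q v = 1" "Q u = 1"
  shows "(sign_class v, sign_class u) \<in> parcs (product_graph {0}) \<longleftrightarrow> B v u = 0"
    and "(sign_class v, sign_class u) \<in> parcs (product_graph {2, 3}) \<longleftrightarrow> B v u \<in> {2, 3}"
proof -
  have "(sign_class v, sign_class u) \<in> parcs (product_graph {0}) \<longleftrightarrow> B v u \<in> {0}"
    by (rule product_graph_arc_iff) (use uminus_closed not_one assms in auto)
  thus "(sign_class v, sign_class u) \<in> parcs (product_graph {0}) \<longleftrightarrow> B v u = 0"
    by simp
  show "(sign_class v, sign_class u) \<in> parcs (product_graph {2, 3}) \<longleftrightarrow> B v u \<in> {2, 3}"
    by (rule product_graph_arc_iff) (use uminus_closed not_one assms in auto)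
qed

lemma S_plus_memD: "p \<in> S_plus Q \<Longrightarrow> v \<in> p \<Longrightarrow> Q v = 1 \<and> p = sign_class v"
  by (auto simp: S_plus_eq sign_class_def)

text \<open>Bridges the relations, which quantify over members of the points, and
  \<open>product_graph\<close>, which is written with representatives.\<close>

lemma relation_representatives:
  "{(p, q) \<in> S_plus Q \<times> S_plus Q. \<exists>v\<in>p. \<exists>u\<in>q. P p q v u} =
    {(sign_class v, sign_class u) | v u. Q v = 1 \<and> Q u = 1 \<and> P (sign_class v) (sign_class u) v u}"
  (is "?L = ?R")
proof (intro equalityI subrelI)
  fix p q assume "(p, q) \<in> ?L"
  then obtain v u where *: "p \<in> S_plus Q" "q \<in> S_plus Q" "v \<in> p" "u \<in> q" "P p q v u"
    by blast
  have "Q v = 1 \<and> p = sign_class v" "Q u = 1 \<and> q = sign_class u"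
    using * S_plus_memD by blast+
  with *(5) show "(p, q) \<in> ?R"
    by blast
next
  fix p q assume "(p, q) \<in> ?R"
  then obtain v u where "p = sign_class v" "q = sign_class u" "Q v = 1" "Q u = 1" "P p q v u"
    by blast
  moreover have "v \<in> sign_class v" "u \<in> sign_class u"
    by (simp_all add: sign_class_def)
  ultimately show "(p, q) \<in> ?L"
    by (auto simp: S_plus_eq)
qed

lemma R0_eq: "R0 Q = parcs (product_graph {0})"
  unfolding R0_def relation_representatives by (simp add: product_graph_def)

lemma R2_eq: "R2 Q = parcs (product_graph {2, 3})"
  unfolding R2_def relation_representatives by (simp add: product_graph_def minus_field)

lemma R1_iff:
  assumes "Q v = 1" "Q u = 1"
  shows "(sign_class v, sign_class u) \<in> R1 Q \<longleftrightarrow>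
    sign_class v \<noteq> sign_class u \<and> B v u \<in> {1, 4}"
proof -
  have neg: "- x = 1 \<longleftrightarrow> x = 4" "- x = 4 \<longleftrightarrow> x = 1" for x :: 'f
    by (metis minus_field(3) minus_minus)+
  have "(sign_class v, sign_class u) \<in> R1 Q \<longleftrightarrow> sign_class v \<noteq> sign_class u \<and>
      (\<exists>v'\<in>sign_class v. \<exists>u'\<in>sign_class u. B v' u' \<in> {1, 4})"
    using assms by (simp add: R1_def S_plus_eq minus_field)
  also have "(\<exists>v'\<in>sign_class v. \<exists>u'\<in>sign_class u. B v' u' \<in> {1, 4}) \<longleftrightarrow> B v u \<in> {1, 4}"
    by (auto simp: sign_class_def B_minus_left B_minus_right neg)
  finally show ?thesis .
qed

text \<open>F_5 is partitioned into {0}, {2, 3} and {1, 4}, so \<open>R1\<close> is what the other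
  two relations leave of the pairs of distinct points.\<close>

lemma R1_eq: "R1 Q = {(p, q) \<in> S_plus Q \<times> S_plus Q. p \<noteq> q} - R0 Q - R2 Q"
proof -
  have "(sign_class v, sign_class u) \<in> R1 Q \<longleftrightarrow>
      sign_class v \<noteq> sign_class u \<and>
      (sign_class v, sign_class u) \<notin> R0 Q \<and> (sign_class v, sign_class u) \<notin> R2 Q"
    if vu: "Q v = 1" "Q u = 1" for v u
  proof -
    have "B v u \<in> {1, 4} \<longleftrightarrow> B v u \<noteq> 0 \<and> B v u \<notin> {2, 3}"
      using field_cases5[of "B v u"] of_int_eq_iff5[of 0 4] by (auto simp: numeral_eq_iff5)
    thus ?thesis
      unfolding R0_eq R2_eq R1_iff[OF vu] arc_iff[OF vu] by simp
  qed
  hence *: "(p, q) \<in> R1 Q \<longleftrightarrow> p \<noteq> q \<and> (p, q) \<notin> R0 Q \<and> (p, q) \<notin> R2 Q"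
    if "p \<in> S_plus Q" "q \<in> S_plus Q" for p q
    using that unfolding S_plus_eq by blast
  have "R1 Q \<subseteq> S_plus Q \<times> S_plus Q"
    unfolding R1_def by blast
  thus ?thesis
    using * by (intro equalityI subrelI) blast+
qed

end

lemma pair_graph_arcD:
  assumes "pair_graph G" "(p, q) \<in> parcs G"
  shows "p \<in> pverts G \<and> q \<in> pverts G \<and> p \<noteq> q"
proof -
  interpret pair_graph G
    by fact
  show ?thesis
    using assms(2) in_arcsD1 in_arcsD2 no_loops' by blast
qed

context form5
begin

lemma S_plus_cases:
  assumes "p \<in> S_plus Q"
  obtains v where "p = sign_class v" "Q v = 1"
  using assms by (auto simp: S_plus_eq)

text \<open>This recognises the graph of A_1 + A_2. What has to be checked is that \<open>R2\<close>
  has no loops and does not meet \<open>R0\<close>: the values 2 and 3 differ from 0, 1 and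
  -1.\<close>

lemma complement_orthogonality_graph:
  "complement_graph (product_graph {0}) = \<lparr>pverts = S_plus Q, parcs = R1 Q \<union> R2 Q\<rparr>"
proof -
  have R2: "p \<in> S_plus Q" "q \<in> S_plus Q" "p \<noteq> q" "(p, q) \<notin> R0 Q" if pq: "(p, q) \<in> R2 Q" for p q
  proof -
    show p: "p \<in> S_plus Q" and q: "q \<in> S_plus Q"
      using pq by (auto simp: R2_def)
    obtain v u where vu: "p = sign_class v" "q = sign_class u" "Q v = 1" "Q u = 1"
      using p q S_plus_cases by metis
    have "B v u \<in> {2, 3}"
      using pq unfolding R2_eq vu(1,2) arc_iff[OF vu(3,4)] .
    hence "B v u \<noteq> 0" "B v u \<noteq> 1" "B v u \<noteq> - 1"
      by (auto simp: numeral_eq_iff5)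
    thus "(p, q) \<notin> R0 Q" "p \<noteq> q"
      unfolding R0_eq vu(1,2) arc_iff[OF vu(3,4)] using vu(4)
      by (auto simp: sign_class_eq_iff B_self B_minus_left)
  qed
  have "{(p, q) \<in> S_plus Q \<times> S_plus Q. p \<noteq> q \<and> (p, q) \<notin> R0 Q} = R1 Q \<union> R2 Q"
    unfolding R1_eq using R2 by blast
  thus ?thesis
    unfolding complement_graph_def R0_eq by (simp add: product_graph_def)
qed

lemma R1_R2_disjoint: "R1 Q \<inter> R2 Q = {}"
  unfolding R1_eq by blast

section \<open>Parameters of the graphs in dimension 2 * j + 5\<close>

context
  fixes j :: nat and D :: int
  assumes dim: "CARD('n) = 2 * j + 5"
  defines "D \<equiv> quadratic_character (form_det Q)"
begin

lemma card_S_plus: "2 * int (card (S_plus Q)) = 5 ^ (2 * j + 4) + D * 5 ^ (j + 2)"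
  using card_quadric_sign_classes[of "\<lambda>_. True"] card_quadric[OF dim]
  by (simp add: S_plus_eq D_def)

lemma card_section:
  assumes "Q v = 1" "c \<in> {0, 2, 3}"
  shows "int (card {u. Q u = 1 \<and> B v u = c}) = 5 ^ (2 * j + 3) - D * 5 ^ (j + 1)"
  unfolding card_quadric_section[OF dim assms(1)] line_sum[OF assms(2)] D_def by simp

lemma degree_0:
  assumes "Q v = 1"
  shows "2 * int (card (nbrs (product_graph {0}) (sign_class v))) = 5 ^ (2 * j + 3) - D * 5 ^ (j + 1)"
proof -
  have "2 * int (card (nbrs (product_graph {0}) (sign_class v))) =
      (\<Sum>c\<in>{0}. int (card {u. Q u = 1 \<and> B v u = c}))"
    by (rule card_nbrs_product_graph) (use uminus_closed not_one assms in auto)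
  thus ?thesis
    using card_section[OF assms, of 0] by simp
qed

lemma degree_2:
  assumes "Q v = 1"
  shows "int (card (nbrs (product_graph {2, 3}) (sign_class v))) = 5 ^ (2 * j + 3) - D * 5 ^ (j + 1)"
proof -
  have "2 * int (card (nbrs (product_graph {2, 3}) (sign_class v))) =
      (\<Sum>c\<in>{2, 3}. int (card {u. Q u = 1 \<and> B v u = c}))"
    by (rule card_nbrs_product_graph) (use uminus_closed not_one assms in auto)
  thus ?thesis
    using card_section[OF assms, of 2] card_section[OF assms, of 3] by (simp add: numeral_eq_iff5)
qed

lemma common_nbrs_0:
  assumes "Q v = 1" "Q w = 1" "sign_class w \<noteq> sign_class v"
  shows "2 * int (common_nbrs (product_graph {0}) (sign_class v) (sign_class w)) =
    5 ^ (2 * j + 2) + (if B v w = 0 then 1 else -1) * D * 5 ^ (j + 1)"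
proof -
  have ne: "w \<noteq> v" "w \<noteq> - v"
    using assms(3) by (auto simp: sign_class_eq_iff)
  have "2 * int (common_nbrs (product_graph {0}) (sign_class v) (sign_class w)) =
      (\<Sum>c\<in>{0}. \<Sum>d\<in>{0}. int (card {u. Q u = 1 \<and> B v u = c \<and> B w u = d}))"
    by (rule card_common_nbrs_product_graph) (use uminus_closed not_one assms in auto)
  also have "\<dots> = 5 ^ (2 * j + 2) + D * 5 ^ j * plane_sum (B v w) 0 0"
    by (simp add: card_quadric_section2[OF dim assms(1,2) ne] D_def)
  finally show ?thesis
    by (simp add: plane_sum_0_0)
qed

text \<open>Of the four sections, one for each choice of two values in {2, 3}, only the total is
  known from \<open>plane_sum_2_2\<close>; halving it, for the passage to pairs, gives the 2 in the
  main term and the coefficients 2 and 1 of the error term.\<close>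

lemma common_nbrs_2:
  assumes "Q v = 1" "Q w = 1" "sign_class w \<noteq> sign_class v"
  shows "int (common_nbrs (product_graph {2, 3}) (sign_class v) (sign_class w)) =
    2 * 5 ^ (2 * j + 2) - (if B v w = 0 then 2 else 1) * D * 5 ^ (j + 1)"
proof -
  have ne: "w \<noteq> v" "w \<noteq> - v"
    using assms(3) by (auto simp: sign_class_eq_iff)
  have "2 * int (common_nbrs (product_graph {2, 3}) (sign_class v) (sign_class w)) =
      (\<Sum>c\<in>{2, 3}. \<Sum>d\<in>{2, 3}. int (card {u. Q u = 1 \<and> B v u = c \<and> B w u = d}))"
    by (rule card_common_nbrs_product_graph) (use uminus_closed not_one assms in auto)
  also have "\<dots> = 4 * 5 ^ (2 * j + 2) + D * 5 ^ j *
      (plane_sum (B v w) 2 2 + plane_sum (B v w) 2 3 + plane_sum (B v w) 3 2 + plane_sum (B v w) 3 3)"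
    unfolding card_quadric_section2[OF dim assms(1,2) ne] D_def[symmetric]
    by (simp add: numeral_eq_iff5 distrib_left)
  finally show ?thesis
    unfolding plane_sum_2_2 by (simp split: if_splits)
qed

lemma pverts_product_graph: "pverts (product_graph C) = S_plus Q"
  by (simp add: product_graph_def)

lemma pair_graph_0: "pair_graph (product_graph {0})"
  by (rule pair_graph_product_graph) (use uminus_closed not_one in auto)

lemma orthogonality_graph_strongly_regular:
  "strongly_regular (product_graph {0})
     ((5 ^ (2 * j + 4) + of_int D * 5 ^ (j + 2)) / 2)
     ((5 ^ (2 * j + 3) - of_int D * 5 ^ (j + 1)) / 2)
     ((5 ^ (2 * j + 2) + of_int D * 5 ^ (j + 1)) / 2)
     ((5 ^ (2 * j + 2) - of_int D * 5 ^ (j + 1)) / 2)"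
proof -
  have half: "real m = of_int k / 2" if "2 * int m = k" for m k
  proof -
    have "real_of_int (2 * int m) = of_int k"
      using that by simp
    thus ?thesis by simp
  qed
  have common: "real (common_nbrs (product_graph {0}) p q) =
      (5 ^ (2 * j + 2) + (if (p, q) \<in> parcs (product_graph {0}) then 1 else -1) * of_int D * 5 ^ (j + 1)) / 2"
    if pq: "p \<in> S_plus Q" "q \<in> S_plus Q" "p \<noteq> q" for p q
  proof -
    obtain v w where vw: "p = sign_class v" "q = sign_class w" "Q v = 1" "Q w = 1"
      using pq S_plus_cases by metis
    have "sign_class w \<noteq> sign_class v"
      using pq(3) vw by simp
    from half[OF common_nbrs_0[OF vw(3,4) this]] show ?thesis
      unfolding vw(1,2) arc_iff[OF vw(3,4)] by simp
  qed
  have arcs: "p \<in> S_plus Q \<and> q \<in> S_plus Q \<and> p \<noteq> q" if "(p, q) \<in> parcs (product_graph {0})" for p q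
    using pair_graph_arcD[OF pair_graph_0 that] unfolding pverts_product_graph .
  have "real (card (nbrs (product_graph {0}) p)) = (5 ^ (2 * j + 3) - of_int D * 5 ^ (j + 1)) / 2"
    if "p \<in> S_plus Q" for p
    using that half[OF degree_0] by (auto elim!: S_plus_cases)
  moreover have "real (common_nbrs (product_graph {0}) p q) = (5 ^ (2 * j + 2) + of_int D * 5 ^ (j + 1)) / 2"
    if "(p, q) \<in> parcs (product_graph {0})" for p q
    using common[of p q] arcs[OF that] that by simp
  moreover have "real (common_nbrs (product_graph {0}) p q) = (5 ^ (2 * j + 2) - of_int D * 5 ^ (j + 1)) / 2"
    if "p \<in> S_plus Q" "q \<in> S_plus Q" "p \<noteq> q" "(p, q) \<notin> parcs (product_graph {0})" for p q
    using common[of p q] that by simp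
  moreover have "real (card (S_plus Q)) = (5 ^ (2 * j + 4) + of_int D * 5 ^ (j + 2)) / 2"
    using half[OF card_S_plus] by simp
  ultimately show ?thesis
    unfolding strongly_regular_def regular_def pverts_product_graph using pair_graph_0 by blast
qed

lemma common_nbrs_2_arc:
  assumes "p \<in> S_plus Q" "q \<in> S_plus Q" "p \<noteq> q"
  shows "real (common_nbrs (product_graph {2, 3}) p q) =
    (if (p, q) \<in> R0 Q then 2 * (5 ^ (2 * j + 2) - of_int D * 5 ^ (j + 1))
     else 2 * 5 ^ (2 * j + 2) - of_int D * 5 ^ (j + 1))"
proof -
  obtain v w where vw: "p = sign_class v" "q = sign_class w" "Q v = 1" "Q w = 1"
    using assms S_plus_cases by metis
  have "sign_class w \<noteq> sign_class v"
    using assms(3) vw by simp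
  from arg_cong[OF common_nbrs_2[OF vw(3,4) this], of real_of_int] show ?thesis
    unfolding vw(1,2) R0_eq arc_iff[OF vw(3,4)] by simp
qed

lemma pair_graph_2: "pair_graph (product_graph {2, 3})"
  by (rule pair_graph_product_graph) (use uminus_closed not_one in auto)

lemma regular_2: "regular (product_graph {2, 3}) (5 ^ (2 * j + 3) - of_int D * 5 ^ (j + 1))"
proof -
  have "real (card (nbrs (product_graph {2, 3}) (sign_class v))) = 5 ^ (2 * j + 3) - of_int D * 5 ^ (j + 1)"
    if "Q v = 1" for v
    using arg_cong[OF degree_2[OF that], of real_of_int] by simp
  thus ?thesis
    unfolding regular_def pverts_product_graph by (auto elim!: S_plus_cases)
qed

lemma deza_graph_2:
  "deza_graph (product_graph {2, 3})
     ((5 ^ (2 * j + 4) + of_int D * 5 ^ (j + 2)) / 2)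
     (5 ^ (2 * j + 3) - of_int D * 5 ^ (j + 1))
     (2 * (5 ^ (2 * j + 2) - of_int D * 5 ^ (j + 1)))
     (2 * 5 ^ (2 * j + 2) - of_int D * 5 ^ (j + 1))"
  using pair_graph_2 regular_2 common_nbrs_2_arc orthogonality_graph_strongly_regular
  unfolding deza_graph_def strongly_regular_def pverts_product_graph by simp

lemma edge_regular_2: "edge_regular (product_graph {2, 3})"
proof -
  have "int (common_nbrs (product_graph {2, 3}) p q) = 2 * 5 ^ (2 * j + 2) - D * 5 ^ (j + 1)"
    if pq: "(p, q) \<in> parcs (product_graph {2, 3})" for p q
  proof -
    obtain v w where vw: "p = sign_class v" "q = sign_class w" "Q v = 1" "Q w = 1"
      using pq by (auto simp: product_graph_def)
    have "B v w \<in> {2, 3}"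
      using pq unfolding vw(1,2) arc_iff[OF vw(3,4)] .
    hence "B v w \<noteq> 0"
      by (auto simp: numeral_eq_iff5)
    have "q \<noteq> p"
      using pair_graph_arcD[OF pair_graph_2 pq] by blast
    hence "sign_class w \<noteq> sign_class v"
      unfolding vw(1,2) .
    from common_nbrs_2[OF vw(3,4) this] \<open>B v w \<noteq> 0\<close> show ?thesis
      by (simp add: vw)
  qed
  \<comment> \<open>\<open>edge_regular\<close> asks for a natural number; \<open>nat\<close> loses
    nothing, as the formula has just been shown to be the size of a set.\<close>
  hence "common_nbrs (product_graph {2, 3}) p q = nat (2 * 5 ^ (2 * j + 2) - D * 5 ^ (j + 1))"
    if "(p, q) \<in> parcs (product_graph {2, 3})" for p q
    using that by (metis nat_int)
  thus ?thesis
    unfolding edge_regular_def using pair_graph_2 regular_2 by blast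
qed

lemma if_eq_iff: "(if P then a else b) = c \<longleftrightarrow> (if P then a = c else b = c)"
  by simp

text \<open>The two counts differ by D * 5 ^ (j + 1), which is not 0, and the first is attained
  exactly on \<open>R0\<close>. So its child is the orthogonality graph and the other child is the
  complement.\<close>

lemma deza_children_2:
  "deza_children (product_graph {2, 3})
     (2 * (5 ^ (2 * j + 2) - of_int D * 5 ^ (j + 1)))
     (2 * 5 ^ (2 * j + 2) - of_int D * 5 ^ (j + 1))
     (product_graph {0}) (complement_graph (product_graph {0}))"
proof -
  \<comment> \<open>The determinant is nonzero, so its character is 1 or -1.\<close>
  have "D \<noteq> 0"
    using form_det(1) by (simp add: D_def quadratic_character_def)
  hence ne: "2 * 5 ^ (2 * j + 2) - real_of_int D * 5 ^ (j + 1) \<noteq>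
      2 * (5 ^ (2 * j + 2) - of_int D * 5 ^ (j + 1))"
    by simp
  have R0_sub: "p \<in> S_plus Q \<and> q \<in> S_plus Q \<and> p \<noteq> q" if "(p, q) \<in> R0 Q" for p q
    using pair_graph_arcD[OF pair_graph_0] that unfolding R0_eq pverts_product_graph .
  have child: "deza_child (product_graph {2, 3}) c =
      \<lparr>pverts = S_plus Q, parcs = {(p, q) \<in> S_plus Q \<times> S_plus Q. p \<noteq> q \<and>
        (if (p, q) \<in> R0 Q then 2 * (5 ^ (2 * j + 2) - of_int D * 5 ^ (j + 1))
         else 2 * 5 ^ (2 * j + 2) - of_int D * 5 ^ (j + 1)) = c}\<rparr>" for c
  proof -
    have "(p, q) \<in> S_plus Q \<times> S_plus Q \<and> p \<noteq> q \<and> real (common_nbrs (product_graph {2, 3}) p q) = c \<longleftrightarrow>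
        (p, q) \<in> S_plus Q \<times> S_plus Q \<and> p \<noteq> q \<and>
        (if (p, q) \<in> R0 Q then 2 * (5 ^ (2 * j + 2) - of_int D * 5 ^ (j + 1))
         else 2 * 5 ^ (2 * j + 2) - of_int D * 5 ^ (j + 1)) = c" for p q
      by (intro conj_cong refl, unfold mem_Sigma_iff, elim conjE, subst common_nbrs_2_arc)
        (assumption | rule refl)+
    thus ?thesis
      unfolding deza_child_def pverts_product_graph by (simp only:)
  qed
  have "deza_child (product_graph {2, 3}) (2 * (5 ^ (2 * j + 2) - of_int D * 5 ^ (j + 1))) =
      \<lparr>pverts = S_plus Q, parcs = {(p, q) \<in> S_plus Q \<times> S_plus Q. p \<noteq> q \<and> (p, q) \<in> R0 Q}\<rparr>"
    unfolding child if_eq_iff using ne by (simp, blast)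
  moreover have "{(p, q) \<in> S_plus Q \<times> S_plus Q. p \<noteq> q \<and> (p, q) \<in> R0 Q} = R0 Q"
    using R0_sub by blast
  moreover have "\<lparr>pverts = S_plus Q, parcs = R0 Q\<rparr> = product_graph {0}"
    unfolding R0_eq by (simp add: product_graph_def)
  moreover have "deza_child (product_graph {2, 3}) (2 * 5 ^ (2 * j + 2) - of_int D * 5 ^ (j + 1)) =
      \<lparr>pverts = S_plus Q, parcs = {(p, q) \<in> S_plus Q \<times> S_plus Q. p \<noteq> q \<and> (p, q) \<notin> R0 Q}\<rparr>"
    unfolding child if_eq_iff using ne by (simp; blast?)
  moreover have "\<dots> = complement_graph (product_graph {0})"
    unfolding complement_graph_def R0_eq by (simp add: product_graph_def)
  ultimately show ?thesis
    using ne unfolding deza_children_def by (simp add: insert_commute)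
qed

end

text \<open>-1 = 2^2 is a square in F_5, so the \<epsilon> of the theorem equals mu(det Q).\<close>

lemma quadratic_character_minus_one_power:
  "quadratic_character ((-1) ^ m * x :: 'f) = quadratic_character x"
  using qc_mult[of "-1" x] qc_numeral(3) by (cases "even m") simp_all

end

theorem mainTheorem2:
  fixes Q :: "'f::{field,finite} ^ 'n \<Rightarrow> 'f"
    and n :: nat and \<epsilon> :: real
    and A0 A1 A2 :: "('f ^ 'n) set \<Rightarrow> ('f ^ 'n) set \<Rightarrow> int"
  assumes field_card: "CARD('f) = 5"
    and dim: "CARD('n) = n"
    and n: "n > 3" "odd n"
    and Q: "quadratic_form Q" "nondegenerate Q"
    and eps: "\<epsilon> = of_int (quadratic_character ((-1) ^ ((n - 1) div 2) * form_det Q))"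
    and A0: "A0 = relation_matrix (R0 Q)"
    and A1: "A1 = relation_matrix (R1 Q)"
    and A2: "A2 = relation_matrix (R2 Q)"
  shows "\<exists>G G0 G12.
    pverts G = S_plus Q \<and> adjacency_matrix A2 G \<and>
    pverts G0 = S_plus Q \<and> adjacency_matrix A0 G0 \<and>
    pverts G12 = S_plus Q \<and> adjacency_matrix (\<lambda>p q. A1 p q + A2 p q) G12 \<and>
    edge_regular G \<and>
    deza_graph G
      ((5 ^ (n - 1) + \<epsilon> * 5 ^ ((n - 1) div 2)) / 2)
      (5 ^ (n - 2) - \<epsilon> * 5 ^ ((n - 3) div 2))
      (2 * (5 ^ (n - 3) - \<epsilon> * 5 ^ ((n - 3) div 2)))
      (2 * 5 ^ (n - 3) - \<epsilon> * 5 ^ ((n - 3) div 2)) \<and>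
    strongly_regular G0
      ((5 ^ (n - 1) + \<epsilon> * 5 ^ ((n - 1) div 2)) / 2)
      ((5 ^ (n - 2) - \<epsilon> * 5 ^ ((n - 3) div 2)) / 2)
      ((5 ^ (n - 3) + \<epsilon> * 5 ^ ((n - 3) div 2)) / 2)
      ((5 ^ (n - 3) - \<epsilon> * 5 ^ ((n - 3) div 2)) / 2) \<and>
    (\<exists>N k l m. strongly_regular G12 N k l m) \<and>
    G12 = complement_graph G0 \<and>
    deza_children G
      (2 * (5 ^ (n - 3) - \<epsilon> * 5 ^ ((n - 3) div 2)))
      (2 * 5 ^ (n - 3) - \<epsilon> * 5 ^ ((n - 3) div 2))
      G0 G12"
proof -
  interpret form5 Q
    using field_card Q by unfold_locales
  \<comment> \<open>Being odd and above 3, n is at least 5; hence n = 2 * j + 5 and every truncated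
    difference in the exponents is exact.\<close>
  define j where "j = (n - 5) div 2"
  have n': "n = 2 * j + 5"
    using n unfolding j_def by (auto elim!: oddE)
  hence dim': "CARD('n) = 2 * j + 5"
    using dim by simp
  have idx: "n - 1 = 2 * j + 4" "(n - 1) div 2 = j + 2" "n - 2 = 2 * j + 3" "n - 3 = 2 * j + 2"
    "(n - 3) div 2 = j + 1"
    using n' by simp_all
  have eps': "\<epsilon> = of_int (quadratic_character (form_det Q))"
    using eps by (simp add: quadratic_character_minus_one_power)
  have verts: "pverts (product_graph {2, 3}) = S_plus Q" "pverts (product_graph {0}) = S_plus Q"
    "pverts (complement_graph (product_graph {0})) = S_plus Q"
    by (simp_all add: product_graph_def complement_graph_def)
  have adj: "adjacency_matrix A2 (product_graph {2, 3})" "adjacency_matrix A0 (product_graph {0})"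
    by (simp_all add: adjacency_matrix_def A0 A2 relation_matrix_def R0_eq R2_eq)
  have adj12: "adjacency_matrix (\<lambda>p q. A1 p q + A2 p q) (complement_graph (product_graph {0}))"
    unfolding complement_orthogonality_graph adjacency_matrix_def A1 A2 relation_matrix_def
    using R1_R2_disjoint by auto
  have compl: "\<exists>N k l m. strongly_regular (complement_graph (product_graph {0})) N k l m"
    using complement_strongly_regular[OF orthogonality_graph_strongly_regular[OF dim']] by blast
  show ?thesis
    \<comment> \<open>The halved exponents come first, since they contain n - 1 and n - 3, which are
      themselves rewritten afterwards.\<close>
    unfolding idx(2,5) unfolding idx(1,3,4) eps'
    by (rule exI[of _ "product_graph {2, 3}"], rule exI[of _ "product_graph {0}"],
        rule exI[of _ "complement_graph (product_graph {0})"])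
      (intro conjI refl verts adj adj12 compl edge_regular_2[OF dim'] deza_graph_2[OF dim']
        orthogonality_graph_strongly_regular[OF dim'] deza_children_2[OF dim'])
qed

end
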